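(* Let $n,k\ge 0$ be integers with $n+k\ge 1$, and let $A_{n,k}=C_{n+1}\oplus A_k$ be the ordinal sum of a chain with $n+1$ elements and an antichain with $k$ elements. Then the $\gamma$-vector of the poset associahedron $\mathscr{A}(A_{n,k})$ is nonnegative, i.e. all of its entries are $\ge 0$.
   Context: Posets. $C_m$ is the chain with $m$ elements and $A_k$ the antichain with $k$ elements. The ordinal sum $P\oplus Q$ has underlying set $P\sqcup Q$, with $a\le b$ iff ($a,b\in P$ and $a\le_P b$) or ($a,b\in Q$ and $a\le_Q b$) or ($a\in P$ and $b\in Q$). Poset associahedron. Let $(P,\preceq)$ be a finite connected poset. A subset $\tau\subseteq P$ is connected if it is connected as an induced subgraph of the Hasse diagram of $P$; it is convex if $x,z\in\tau$, $y\in P$, $x\preceq y\preceq z$ imply $y\in\tau$. A tube is a connected convex subset; it is proper if $1<|\tau|<|P|$. Two tubes are nested if one contains the other, and disjoint if their intersection is empty. Write $\sigma\prec\tau$ if $\sigma\cap\tau=\emptyset$ and there are $x\in\sigma$, $y\in\tau$ with $x\preceq y$. A tubing is a set $T$ of proper tubes, any two of which are nested or disjoint, such that there is no subset $\{\tau_1,\ldots,\tau_m\}\subseteq T$ with $\tau_1\prec\tau_2\prec\cdots\prec\tau_m\prec\tau_1$. The poset associahedron $\mathscr{A}(P)$ is a simple convex polytope of dimension $|P|-2$ (it exists by a theorem of Galashin) whose face lattice is the set of tubings of $P$ ordered by reverse inclusion; a tubing with $j$ tubes corresponds to a face of dimension $|P|-2-j$. Face numbers. For a $d$-dimensional simple polytope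 with $f_i$ faces of dimension $i$ ($0\le i\le d$), the $f$-polynomial is $f(t)=\sum_{i=0}^d f_it^i$, and the $h$-polynomial $h(t)=\sum_{i=0}^d h_it^i$ is defined by $f(t)=h(t+1)$. The $h$-vector is symmetric ($h_i=h_{d-i}$), so there is a unique vector $(\gamma_0,\ldots,\gamma_{\lfloor d/2\rfloor})$, the $\gamma$-vector, with $h(t)=\sum_{i=0}^{\lfloor d/2\rfloor}\gamma_i t^i(1+t)^{d-2i}$. *)

theory Defs
  imports "HOL-Analysis.Analysis" "HOL-Computational_Algebra.Polynomial"
begin

section \<open>Posets\<close>

text \<open>A poset is given by its reflexive order relation \<open>P\<close>, where \<open>(x, y) \<in> P\<close> means
  \<open>x \<le> y\<close>; its underlying set is \<open>Field P\<close> and the axioms are \<^term>\<open>Partial_order P\<close>.\<close>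

definition chain :: "nat \<Rightarrow> nat rel" where
  "chain m = {(i, j). i \<le> j \<and> j < m}"

definition antichain :: "nat \<Rightarrow> nat rel" where
  "antichain k = Id_on {..<k}"

definition ordinal_sum :: "'a rel \<Rightarrow> 'b rel \<Rightarrow> ('a + 'b) rel" where
  "ordinal_sum P Q =
     {(Inl a, Inl b) | a b. (a, b) \<in> P} \<union>
     {(Inr a, Inr b) | a b. (a, b) \<in> Q} \<union>
     {(Inl a, Inr b) | a b. a \<in> Field P \<and> b \<in> Field Q}"

definition broom :: "nat \<Rightarrow> nat \<Rightarrow> (nat + nat) rel" where
  "broom n k = ordinal_sum (chain (n + 1)) (antichain k)"

definition covers :: "'a rel \<Rightarrow> 'a rel" where
  "covers P = {(x, y). (x, y) \<in> P \<and> x \<noteq> y \<and>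
     (\<forall>z. (x, z) \<in> P \<and> (z, y) \<in> P \<longrightarrow> z = x \<or> z = y)}"

definition hasse_connected :: "'a rel \<Rightarrow> 'a set \<Rightarrow> bool" where
  "hasse_connected P \<tau> \<longleftrightarrow>
     (\<forall>x\<in>\<tau>. \<forall>y\<in>\<tau>. (x, y) \<in> ((covers P \<union> (covers P)\<inverse>) \<inter> \<tau> \<times> \<tau>)\<^sup>*)"

definition order_convex :: "'a rel \<Rightarrow> 'a set \<Rightarrow> bool" where
  "order_convex P \<tau> \<longleftrightarrow>
     (\<forall>x\<in>\<tau>. \<forall>z\<in>\<tau>. \<forall>y. (x, y) \<in> P \<and> (y, z) \<in> P \<longrightarrow> y \<in> \<tau>)"


section \<open>Tubings\<close>

definition tube :: "'a rel \<Rightarrow> 'a set \<Rightarrow> bool" where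
  "tube P \<tau> \<longleftrightarrow> \<tau> \<subseteq> Field P \<and> hasse_connected P \<tau> \<and> order_convex P \<tau>"

definition proper_tube :: "'a rel \<Rightarrow> 'a set \<Rightarrow> bool" where
  "proper_tube P \<tau> \<longleftrightarrow> tube P \<tau> \<and> 1 < card \<tau> \<and> card \<tau> < card (Field P)"

definition tube_less :: "'a rel \<Rightarrow> 'a set \<Rightarrow> 'a set \<Rightarrow> bool" where
  "tube_less P \<sigma> \<tau> \<longleftrightarrow> \<sigma> \<inter> \<tau> = {} \<and> (\<exists>x\<in>\<sigma>. \<exists>y\<in>\<tau>. (x, y) \<in> P)"

definition tubing :: "'a rel \<Rightarrow> 'a set set \<Rightarrow> bool" where
  "tubing P T \<longleftrightarrow>
     (\<forall>\<tau>\<in>T. proper_tube P \<tau>) \<and>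
     (\<forall>\<sigma>\<in>T. \<forall>\<tau>\<in>T. \<sigma> \<subseteq> \<tau> \<or> \<tau> \<subseteq> \<sigma> \<or> \<sigma> \<inter> \<tau> = {}) \<and>
     acyclic {(\<sigma>, \<tau>). \<sigma> \<in> T \<and> \<tau> \<in> T \<and> tube_less P \<sigma> \<tau>}"


section \<open>Face numbers\<close>

definition polytope_f_poly :: "'v::euclidean_space set \<Rightarrow> int poly" where
  "polytope_f_poly S =
     (\<Sum>i\<le>nat (aff_dim S). monom (int (card {F. F face_of S \<and> aff_dim F = int i})) i)"

text \<open>The solution \<open>h\<close> of \<open>f(t) = h(t + 1)\<close>, that is \<open>h(t) = f(t - 1)\<close>.\<close>

definition h_poly :: "int poly \<Rightarrow> int poly" where
  "h_poly f = pcompose f [:-1, 1:]"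

lemma h_poly_iff: "h = h_poly f \<longleftrightarrow> f = pcompose h [:1, 1:]"
proof -
  have "pcompose (pcompose f [:-1, 1:]) [:1, 1:] = f" 
    by (simp add: pcompose_assoc [symmetric] pcompose_pCons)
  moreover have "pcompose (pcompose h [:1, 1:]) [:-1, 1:] = h"
    by (simp add: pcompose_assoc [symmetric] pcompose_pCons)
  ultimately show ?thesis
    by (auto simp: h_poly_def)
qed

text \<open>A \<open>\<gamma>\<close>-vector exists only for symmetric \<open>h\<close>, so the notion is relational; it is unique
  by \<open>gamma_vector_unique\<close> below.\<close>

definition is_gamma_vector :: "nat \<Rightarrow> int poly \<Rightarrow> int list \<Rightarrow> bool" where
  "is_gamma_vector d h \<gamma> \<longleftrightarrow> length \<gamma> = d div 2 + 1 \<and>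
     h = (\<Sum>i\<le>d div 2. monom (\<gamma> ! i) i * [:1, 1:] ^ (d - 2 * i))"

lemma gamma_expansion_zero:
  fixes c :: "nat \<Rightarrow> int"
  assumes "(\<Sum>i\<le>m. monom (c i) i * [:1, 1:] ^ e i) = 0" "i \<le> m"
  shows "c i = 0"
  using assms(2)
proof (induction i rule: less_induct)
  case (less i)
  have c0: "coeff ([:1, 1:] ^ k :: int poly) 0 = 1" for k
    by (simp add: coeff_0_power)
  have "0 = coeff (\<Sum>j\<le>m. monom (c j) j * [:1, 1:] ^ e j) i"
    using assms(1) by simp
  also have "\<dots> = (\<Sum>j\<le>m. if j = i then c i else 0)"
    unfolding coeff_sum
  proof (intro sum.cong refl)
    fix j assume "j \<in> {..m}"
    show "coeff (monom (c j) j * [:1, 1:] ^ e j) i = (if j = i then c i else 0)"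
      using less.IH[of j] less.prems c0
      by (cases j i rule: linorder_cases) (auto simp: coeff_monom_mult)
  qed
  also have "\<dots> = c i"
    using less.prems by simp
  finally show ?case by simp
qed

lemma gamma_vector_unique:
  assumes "is_gamma_vector d h \<gamma>" "is_gamma_vector d h \<delta>"
  shows "\<gamma> = \<delta>"
proof (rule nth_equalityI)
  show "length \<gamma> = length \<delta>"
    using assms by (simp add: is_gamma_vector_def)
next
  fix i assume i: "i < length \<gamma>"
  have "(\<Sum>i\<le>d div 2. monom (\<gamma> ! i - \<delta> ! i) i * [:1, 1:] ^ (d - 2 * i)) = 0"
    using assms by (simp add: is_gamma_vector_def diff_monom [symmetric] left_diff_distrib sum_subtractf)
  from gamma_expansion_zero[OF this, of i] show "\<gamma> ! i = \<delta> ! i"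
    using i assms by (simp add: is_gamma_vector_def)
qed


section \<open>Poset associahedra\<close>

definition simple_polytope :: "'v::euclidean_space set \<Rightarrow> bool" where
  "simple_polytope S \<longleftrightarrow> polytope S \<and>
     (\<forall>v. v extreme_point_of S \<longrightarrow> int (card {F. F facet_of S \<and> v \<in> F}) = aff_dim S)"

text \<open>The poset associahedron is determined by \<open>P\<close> only up to combinatorial equivalence;
  \<open>S\<close> is one of its realisations. The library's \<^const>\<open>face_of\<close> admits the empty face, which
  does not correspond to a tubing.\<close>

definition poset_associahedron :: "'a rel \<Rightarrow> 'v::euclidean_space set \<Rightarrow> bool" where
  "poset_associahedron P S \<longleftrightarrow>
     simple_polytope S \<and> aff_dim S = int (card (Field P)) - 2 \<and>
     (\<exists>\<phi>. bij_betw \<phi> {T. tubing P T} {F. F face_of S \<and> F \<noteq> {}} \<and>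
          (\<forall>T U. tubing P T \<and> tubing P U \<longrightarrow> (\<phi> T \<subseteq> \<phi> U \<longleftrightarrow> U \<subseteq> T)) \<and>
          (\<forall>T. tubing P T \<longrightarrow>
             aff_dim (\<phi> T) = int (card (Field P)) - 2 - int (card T)))"

definition tubing_f_poly :: "'a rel \<Rightarrow> int poly" where
  "tubing_f_poly P =
     (\<Sum>i\<le>card (Field P) - 2.
        monom (int (card {T. tubing P T \<and> card T + i = card (Field P) - 2})) i)"

lemma polytope_f_poly_eq_tubing_f_poly:
  assumes "poset_associahedron P S" "2 \<le> card (Field P)"
  shows "polytope_f_poly S = tubing_f_poly P"
proof -
  obtain \<phi> where bij: "bij_betw \<phi> {T. tubing P T} {F. F face_of S \<and> F \<noteq> {}}"
    and dim: "\<And>T. tubing P T \<Longrightarrow> aff_dim (\<phi> T) = int (card (Field P)) - 2 - int (card T)"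
    and d: "aff_dim S = int (card (Field P)) - 2"
    using assms(1) unfolding poset_associahedron_def by blast
  have "card {T. tubing P T \<and> card T + i = card (Field P) - 2} =
        card {F. F face_of S \<and> aff_dim F = int i}" for i
  proof (rule bij_betw_same_card[of \<phi>], rule bij_betw_subset[OF bij])
    show "\<phi> ` {T. tubing P T \<and> card T + i = card (Field P) - 2} =
          {F. F face_of S \<and> aff_dim F = int i}" (is "\<phi> ` ?A = ?B")
    proof (intro set_eqI iffI)
      fix F assume "F \<in> \<phi> ` ?A"
      then obtain T where T: "tubing P T" "card T + i = card (Field P) - 2" "F = \<phi> T"
        by blast
      have "F face_of S"
        using bij T by (auto simp: bij_betw_def)
      moreover have "aff_dim F = int i"
        using dim[OF T(1)] T assms(2) by simp
      ultimately show "F \<in> ?B" by simp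
    next
      fix F assume F: "F \<in> ?B"
      then have "F \<noteq> {}" by auto
      with F have "F \<in> \<phi> ` {T. tubing P T}"
        using bij by (auto simp: bij_betw_def)
      then obtain T where T: "tubing P T" "F = \<phi> T" by blast
      have "card T + i = card (Field P) - 2"
        using dim[OF T(1)] F T assms(2) by auto
      with T show "F \<in> \<phi> ` ?A" by blast
    qed
  qed auto
  moreover have "nat (aff_dim S) = card (Field P) - 2"
    using d by simp
  ultimately show ?thesis
    by (simp add: polytope_f_poly_def tubing_f_poly_def)
qed


section \<open>Brooms are finite connected posets\<close>

lemma Field_chain: "Field (chain m) = {..<m}"
  by (auto simp: chain_def Field_def)

lemma Field_antichain: "Field (antichain k) = {..<k}"
  by (auto simp: antichain_def Field_def)

lemma Field_ordinal_sum: "Field (ordinal_sum P Q) = Field P <+> Field Q"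
proof (intro set_eqI)
  have Field_iff: "x \<in> Field r \<longleftrightarrow> (\<exists>y. (x, y) \<in> r \<or> (y, x) \<in> r)" for x :: "'a + 'b" and r
    by (auto simp: Field_def)
  fix x :: "'a + 'b"
  show "x \<in> Field (ordinal_sum P Q) \<longleftrightarrow> x \<in> Field P <+> Field Q"
    unfolding Field_iff
    by (cases x) (auto simp: ordinal_sum_def, (auto simp: Field_def)+)
qed

lemma Field_broom: "Field (broom n k) = {..<n + 1} <+> {..<k}"
  by (simp add: broom_def Field_ordinal_sum Field_chain Field_antichain)

lemma card_Field_broom: "card (Field (broom n k)) = n + 1 + k"
  by (simp add: Field_broom card_Plus)

lemma Partial_order_broom: "Partial_order (broom n k)"
  unfolding partial_order_on_def preorder_on_def Field_broom
  by (auto simp: broom_def ordinal_sum_def chain_def antichain_def Field_def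
      intro!: refl_onI transI antisymI)

lemma hasse_connected_broom: "hasse_connected (broom n k) (Field (broom n k))"
proof -
  define E where "E = (covers (broom n k) \<union> (covers (broom n k))\<inverse>) \<inter>
                      Field (broom n k) \<times> Field (broom n k)"
  have "sym E"
    by (auto simp: E_def sym_def)
  have up: "(Inl i, Inl (Suc i)) \<in> E" if "Suc i < n + 1" for i
    using that by (auto simp: E_def covers_def Field_broom)
      (auto simp: broom_def ordinal_sum_def chain_def)
  have leaf: "(Inl n, Inr j) \<in> E" if "j < k" for j
    using that by (auto simp: E_def covers_def Field_broom)
      (auto simp: broom_def ordinal_sum_def chain_def antichain_def Field_def)
  have L: "(Inl 0, Inl i) \<in> E\<^sup>*" if "i < n + 1" for i
    using that by (induction i) (auto intro: rtrancl_into_rtrancl[OF _ up])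
  have R: "(Inl 0, Inr j) \<in> E\<^sup>*" if "j < k" for j
    using L[of n] leaf[OF that] by auto
  have from0: "(Inl 0, x) \<in> E\<^sup>*" if "x \<in> Field (broom n k)" for x
    using that L R by (auto simp: Field_broom)
  have "(x, y) \<in> E\<^sup>*" if "x \<in> Field (broom n k)" "y \<in> Field (broom n k)" for x y
    using from0[OF that(1)] from0[OF that(2)] sym_rtrancl[OF \<open>sym E\<close>]
    by (meson rtrancl_trans symD)
  then show ?thesis
    by (simp add: hasse_connected_def E_def)
qed

end

theory Submission
  imports Defs "HOL-Computational_Algebra.Formal_Power_Series"
begin

text \<open>
  Write \<open>h(n, k)\<close> for the \<open>h\<close>-polynomial of the tubings of the broom \<open>C\<^bsub>n+1\<^esub> \<oplus> A\<^bsub>k\<^esub>\<close>, with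
  \<open>p\<^sub>n = h(n, 0)\<close> (chains, where the polytope is an associahedron) and \<open>q\<^sub>k = h(0, k)\<close> (stars, where it
  is a permutohedron). In the variable \<open>t\<close>,
  they satisfy \<open>p\<^sub>1 = q\<^sub>1 = 1\<close> and, for \<open>n, k \<ge> 1\<close>,

  \<^item> \<open>p\<^bsub>n+1\<^esub> = (1 + t) p\<^sub>n + t (\<Sum>i=1..n-1. p\<^sub>i p\<^bsub>n-i\<^esub>)\<close>,
  \<^item> \<open>q\<^bsub>k+1\<^esub> = (1 + t) q\<^sub>k + t (\<Sum>j=1..k-1. (k choose j) q\<^sub>j q\<^bsub>k-j\<^esub>)\<close>,
  \<^item> \<open>h(n, k) = (1 + t) p\<^sub>n q\<^sub>k + t (\<Sum>(i, j) \<noteq> (n, k). (k choose j) p\<^sub>i q\<^sub>j h(n - i, k - j))\<close>,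

  where \<open>i\<close> and \<open>j\<close> start at \<open>1\<close> in the last sum. Call a polynomial \<open>\<gamma>\<close>-nonnegative of degree \<open>d\<close> if it
  is a nonnegative combination of the \<open>t\<^sup>i (1 + t)\<^bsup>d-2i\<^esup>\<close>. Such polynomials can be added, multiplied
  (degrees add), multiplied by \<open>1 + t\<close> (degree \<open>+1\<close>) and by \<open>t\<close> (degree \<open>+2\<close>), and every summand on the
  right has the same degree as the left side. So \<open>\<gamma>\<close>-nonnegativity follows by induction.

  The recursions come from the combinatorics of tubings as follows. A tube with at least two
  elements is an interval of the chain, or an interval ending at the top of the chain together with
  some leaves. For such tubes the acyclicity condition is automatic, because the relation between
  disjoint tubes strictly increases the least chain element; a tubing is therefore the same as a
  laminar family of proper tubes. Given such a family, let \<open>\<tau>\<close> be its largest tube through the top of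
  the chain, or the top alone if there is none. The rest of the family splits into a family inside
  \<open>\<tau>\<close>, which is a smaller broom, and a family in the part of the chain below \<open>\<tau>\<close>, in which the whole part may
  itself be a tube; the leaves outside \<open>\<tau>\<close> are only counted (\<open>broom_poly_rec\<close>).

  Take generating functions, ordinary in \<open>n\<close> and exponential in \<open>k\<close>, in the variable \<open>y = t - 1\<close> of the
  \<open>f\<close>-polynomial. Then the splitting reads \<open>W = 1 + W G\<close> with \<open>G = s + E + y s E\<close>, where \<open>s\<close> depends only
  on the chain and \<open>E = (exp (y v) - 1) / y\<close> only on the leaves. Specialising to chains and to stars gives
  \<open>1 / (1 - s) = 1 + p\<close> and \<open>1 / (1 - E) = 1 + q\<close>, and eliminating \<open>s\<close> and \<open>E\<close> leaves
  \<open>W = (1 + p) (1 + q) + (1 + y) p q W\<close>, which is the third recursion. The second one is the differential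
  equation \<open>q' = 1 + (2 + y) q + (1 + y) q\<^sup>2\<close>, a consequence of \<open>E' = 1 + y E\<close>; the first one is a
  direct reading of the splitting for chains.
\<close>

section \<open>Gamma-nonnegative polynomials\<close>

text \<open>The nonnegative cone spanned by the \<open>t\<^sup>i (1 + t)\<^bsup>d-2i\<^esup>\<close>. Generating it by adding one basis
  vector at a time makes closure under products a double induction on single terms and avoids
  convolving coefficient vectors.\<close>

inductive gamma_nonneg :: "nat \<Rightarrow> int poly \<Rightarrow> bool" where
  gamma_nonneg_0: "gamma_nonneg d 0"
| gamma_nonneg_add_term: "gamma_nonneg d p \<Longrightarrow> 2 * i \<le> d \<Longrightarrow>
    gamma_nonneg d (p + monom 1 i * [:1, 1:] ^ (d - 2 * i))"

lemma gamma_nonneg_add: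
  assumes "gamma_nonneg d p" "gamma_nonneg d q"
  shows "gamma_nonneg d (p + q)"
  using assms(2,1)
proof (induction rule: gamma_nonneg.induct)
  case (gamma_nonneg_add_term d q i)
  then show ?case
    using gamma_nonneg.gamma_nonneg_add_term[of d "p + q" i] by (simp add: add.assoc)
qed simp_all

lemma gamma_nonneg_sum:
  "(\<And>i. i \<in> A \<Longrightarrow> gamma_nonneg d (f i)) \<Longrightarrow> gamma_nonneg d (sum f A)"
  by (induction A rule: infinite_finite_induct) (auto intro: gamma_nonneg_0 gamma_nonneg_add)

lemma gamma_nonneg_of_nat_mult:
  "gamma_nonneg d p \<Longrightarrow> gamma_nonneg d (of_nat c * p)"
  by (induction c) (auto simp: ring_distribs intro: gamma_nonneg_0 gamma_nonneg_add)

lemma gamma_nonneg_term: "2 * i \<le> d \<Longrightarrow> gamma_nonneg d (monom 1 i * [:1, 1:] ^ (d - 2 * i))"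
  using gamma_nonneg_add_term[OF gamma_nonneg_0, of i d] by simp

text \<open>Basis vectors multiply to basis vectors:
  \<open>t\<^sup>i (1 + t)\<^bsup>d-2i\<^esup> * t\<^sup>j (1 + t)\<^bsup>e-2j\<^esup> = t\<^bsup>i+j\<^esup> (1 + t)\<^bsup>(d+e)-2(i+j)\<^esup>\<close>.\<close>

lemma gamma_nonneg_mult:
  assumes "gamma_nonneg d p" "gamma_nonneg e q"
  shows "gamma_nonneg (d + e) (p * q)"
  using assms
proof (induction rule: gamma_nonneg.induct)
  case (gamma_nonneg_add_term d p i)
  have "gamma_nonneg (d + e) (monom 1 i * [:1, 1:] ^ (d - 2 * i) * q)"
    using gamma_nonneg_add_term.prems
  proof (induction rule: gamma_nonneg.induct)
    case (gamma_nonneg_add_term e q j)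
    have split: "d + e - 2 * (i + j) = (d - 2 * i) + (e - 2 * j)"
      using gamma_nonneg_add_term.hyps \<open>2 * i \<le> d\<close> by simp
    have ij: "monom 1 (i + j) = monom (1 :: int) i * monom 1 j"
      by (simp add: mult_monom)
    have "monom 1 i * [:1, 1:] ^ (d - 2 * i) * (monom 1 j * [:1, 1:] ^ (e - 2 * j)) =
        monom (1 :: int) (i + j) * [:1, 1:] ^ (d + e - 2 * (i + j))"
      unfolding split power_add ij by (simp only: ac_simps)
    then show ?case
      using gamma_nonneg.gamma_nonneg_add_term[OF gamma_nonneg_add_term.IH, of "i + j"]
        gamma_nonneg_add_term.hyps \<open>2 * i \<le> d\<close> by (simp add: distrib_left)
  qed (simp add: gamma_nonneg_0)
  then show ?case
    using gamma_nonneg_add[OF gamma_nonneg_add_term.IH[OF gamma_nonneg_add_term.prems]]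
    by (simp add: distrib_right)
qed (simp add: gamma_nonneg_0)

lemma gamma_nonneg_1: "gamma_nonneg 0 1"
  using gamma_nonneg_term[of 0 0] by simp

lemma gamma_nonneg_one_plus: "gamma_nonneg 1 [:1, 1:]"
  using gamma_nonneg_term[of 0 1] by simp

lemma gamma_nonneg_var: "gamma_nonneg 2 [:0, 1:]"
  using gamma_nonneg_term[of 1 2] by (simp add: monom_altdef)

lemma gamma_nonneg_one_plus_mult: "gamma_nonneg d p \<Longrightarrow> gamma_nonneg (Suc d) ([:1, 1:] * p)"
  using gamma_nonneg_mult[OF gamma_nonneg_one_plus, of d p] by simp

lemma gamma_nonneg_var_mult: "gamma_nonneg d p \<Longrightarrow> gamma_nonneg (Suc (Suc d)) ([:0, 1:] * p)"
  using gamma_nonneg_mult[OF gamma_nonneg_var, of d p] by simp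

lemma gamma_nonneg_imp_gamma_vector:
  assumes "gamma_nonneg d h"
  shows "\<exists>\<gamma>. is_gamma_vector d h \<gamma> \<and> (\<forall>c \<in> set \<gamma>. 0 \<le> c)"
  using assms
proof (induction rule: gamma_nonneg.induct)
  case (gamma_nonneg_0 d)
  show ?case
    by (rule exI[of _ "replicate (d div 2 + 1) 0"])
      (auto simp: is_gamma_vector_def simp del: replicate_Suc intro!: sum.neutral[symmetric])
next
  case (gamma_nonneg_add_term d p i)
  then obtain \<gamma> where \<gamma>: "is_gamma_vector d p \<gamma>" "\<forall>c \<in> set \<gamma>. 0 \<le> c"
    by blast
  have len: "length \<gamma> = d div 2 + 1" and i: "i \<le> d div 2"
    using \<gamma> gamma_nonneg_add_term.hyps by (auto simp: is_gamma_vector_def)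
  let ?g = "\<lambda>j. [:1, 1:] ^ (d - 2 * j) :: int poly"
  have "(\<Sum>j\<le>d div 2. monom (\<gamma>[i := \<gamma> ! i + 1] ! j) j * ?g j) =
      (\<Sum>j\<le>d div 2. monom (\<gamma> ! j) j * ?g j + (if j = i then monom 1 i * ?g i else 0))"
    using len by (intro sum.cong) (auto simp: nth_list_update add_monom [symmetric] distrib_right)
  also have "\<dots> = p + monom 1 i * ?g i"
    using \<gamma>(1) i by (simp add: sum.distrib is_gamma_vector_def)
  finally have "is_gamma_vector d (p + monom 1 i * ?g i) (\<gamma>[i := \<gamma> ! i + 1])"
    using len by (simp add: is_gamma_vector_def)
  moreover have "\<forall>c \<in> set (\<gamma>[i := \<gamma> ! i + 1]). 0 \<le> c"
    using \<gamma>(2) len i set_update_subset_insert[of \<gamma> i "\<gamma> ! i + 1"]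
    by (metis insert_iff less_Suc_eq_le Suc_eq_plus1 nth_mem add_nonneg_nonneg subset_iff zero_le_one)
  ultimately show ?case
    by blast
qed

section \<open>Laminar families\<close>

definition laminar :: "'a set set \<Rightarrow> bool" where
  "laminar T \<longleftrightarrow> (\<forall>\<sigma>\<in>T. \<forall>\<tau>\<in>T. \<sigma> \<subseteq> \<tau> \<or> \<tau> \<subseteq> \<sigma> \<or> \<sigma> \<inter> \<tau> = {})"

text \<open>Nested families in a set system \<open>B\<close> below a set \<open>V\<close>. In \<open>nestings\<close> the members are proper
  subsets of \<open>V\<close>, as in a tubing of \<open>V\<close>; \<open>weak_nestings\<close> also allows \<open>V\<close> itself, as is needed for the
  part of a tube lying outside a maximal subtube.\<close>

definition nestings :: "'a set set \<Rightarrow> 'a set \<Rightarrow> 'a set set set" where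
  "nestings B V = {T. T \<subseteq> B \<and> laminar T \<and> (\<forall>\<sigma>\<in>T. \<sigma> \<subset> V)}"

definition weak_nestings :: "'a set set \<Rightarrow> 'a set \<Rightarrow> 'a set set set" where
  "weak_nestings B V = {T. T \<subseteq> B \<and> laminar T \<and> (\<forall>\<sigma>\<in>T. \<sigma> \<subseteq> V)}"

text \<open>If \<open>V\<close> has at least two elements and the members of \<open>B\<close> do too, then a nesting has at most \<open>card V - 2\<close>
  members, so \<open>nesting_poly\<close> is the value at \<open>y\<close> of the polynomial counting nestings by
  codimension, which is the \<open>f\<close>-polynomial when nestings are tubings. On a singleton the truncated
  exponent is \<open>0\<close>, giving the value \<open>1\<close>. The bound for weak nestings of a nonempty set is
  \<open>card V - 1\<close>, which explains the other exponent.\<close>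

definition nesting_poly :: "'a set set \<Rightarrow> 'r::comm_ring_1 \<Rightarrow> 'a set \<Rightarrow> 'r" where
  "nesting_poly B y V = (\<Sum>T\<in>nestings B V. y ^ (card V - 2 - card T))"

definition weak_nesting_poly :: "'a set set \<Rightarrow> 'r::comm_ring_1 \<Rightarrow> 'a set \<Rightarrow> 'r" where
  "weak_nesting_poly B y V = (\<Sum>T\<in>weak_nestings B V. y ^ (card V - 1 - card T))"

text \<open>The largest member of \<open>T\<close> through the point \<open>b\<close>. When no member contains \<open>b\<close> the value is \<open>{b}\<close>, so
  that this degenerate case can be treated like a member.\<close>

definition outermost :: "'a \<Rightarrow> 'a set set \<Rightarrow> 'a set" where
  "outermost b T = {b} \<union> \<Union>{\<sigma>\<in>T. b \<in> \<sigma>}"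

lemma finite_weak_nestings: "finite V \<Longrightarrow> finite (weak_nestings B V)"
  by (rule finite_subset[of _ "Pow (Pow V)"]) (auto simp: weak_nestings_def)

lemma finite_nestings: "finite V \<Longrightarrow> finite (nestings B V)"
  by (rule finite_subset[of _ "Pow (Pow V)"]) (auto simp: nestings_def)

lemma finite_weak_nesting: "T \<in> weak_nestings B V \<Longrightarrow> finite V \<Longrightarrow> finite T"
  by (rule finite_subset[of _ "Pow V"]) (auto simp: weak_nestings_def)

lemma finite_nesting: "T \<in> nestings B V \<Longrightarrow> finite V \<Longrightarrow> finite T"
  by (rule finite_subset[of _ "Pow V"]) (auto simp: nestings_def)

lemma laminarD: "laminar T \<Longrightarrow> \<sigma> \<in> T \<Longrightarrow> \<tau> \<in> T \<Longrightarrow> \<sigma> \<subseteq> \<tau> \<or> \<tau> \<subseteq> \<sigma> \<or> \<sigma> \<inter> \<tau> = {}"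
  by (auto simp: laminar_def)

lemma laminar_subset: "laminar T \<Longrightarrow> U \<subseteq> T \<Longrightarrow> laminar U"
  unfolding laminar_def by blast

lemma laminar_insert_top: "laminar T \<Longrightarrow> \<forall>\<sigma>\<in>T. \<sigma> \<subseteq> \<tau> \<Longrightarrow> laminar (insert \<tau> T)"
  by (auto simp: laminar_def)

lemma Union_chain_mem:
  assumes "finite M" "M \<noteq> {}" "\<And>\<sigma> \<tau>. \<sigma> \<in> M \<Longrightarrow> \<tau> \<in> M \<Longrightarrow> \<sigma> \<subseteq> \<tau> \<or> \<tau> \<subseteq> \<sigma>"
  shows "\<Union>M \<in> M"
proof (rule Union_in_chain[OF assms(1,2)])
  show "subset.chain UNIV M"
    unfolding subset_chain_def using assms(3) by simp
qed

lemma outermost_cases: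
  assumes T: "T \<in> nestings B V" and "finite V"
  shows "outermost b T = {b} \<and> (\<forall>\<sigma>\<in>T. b \<in> \<sigma> \<longrightarrow> \<sigma> = {b}) \<or> outermost b T \<in> T \<and> b \<in> outermost b T"
proof (cases "{\<sigma>\<in>T. b \<in> \<sigma>} = {}")
  case False
  have lam: "laminar T"
    using T by (simp add: nestings_def)
  have fin: "finite {\<sigma> \<in> T. b \<in> \<sigma>}"
    using finite_nesting[OF assms] by simp
  have "\<Union>{\<sigma>\<in>T. b \<in> \<sigma>} \<in> {\<sigma>\<in>T. b \<in> \<sigma>}"
  proof (rule Union_chain_mem[OF fin False])
    fix \<sigma> \<tau> assume "\<sigma> \<in> {\<sigma>\<in>T. b \<in> \<sigma>}" "\<tau> \<in> {\<sigma>\<in>T. b \<in> \<sigma>}"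
    then have "\<sigma> \<in> T" "\<tau> \<in> T" "\<sigma> \<inter> \<tau> \<noteq> {}"
      by auto
    then show "\<sigma> \<subseteq> \<tau> \<or> \<tau> \<subseteq> \<sigma>"
      using laminarD[OF lam, of \<sigma> \<tau>] by simp
  qed
  moreover have "outermost b T = \<Union>{\<sigma>\<in>T. b \<in> \<sigma>}"
    using False by (auto simp: outermost_def)
  ultimately have "outermost b T \<in> {\<sigma>\<in>T. b \<in> \<sigma>}"
    by (simp only:)
  then show ?thesis
    by simp
next
  case True
  then have "outermost b T = {b}"
    unfolding outermost_def by (simp only: Union_empty Un_empty_right)
  with True show ?thesis by auto
qed

text \<open>The members through \<open>b\<close> form a chain. Every other member is either inside the largest of them or
  disjoint from it, by laminarity; hence a family is determined by its outermost member through \<open>b\<close>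
  and its restrictions to that member and to the complement, and these can be chosen freely.\<close>

lemma nestings_outermost_bij:
  fixes B :: "'a set set"
  assumes B: "\<forall>\<sigma>\<in>B. 1 < card \<sigma>"
    and V: "finite V" "b \<in> V" "1 < card V"
  defines "H \<equiv> insert {b} {\<sigma> \<in> B. b \<in> \<sigma> \<and> \<sigma> \<subset> V}"
  shows "bij_betw (\<lambda>(\<tau>, T1, T2). ({\<tau>} \<inter> B) \<union> T1 \<union> T2)
    (SIGMA \<tau>:H. nestings B \<tau> \<times> weak_nestings B (V - \<tau>)) (nestings B V)"
    (is "bij_betw ?f ?S _")
proof (rule bij_betwI[where g = "\<lambda>T. (outermost b T, {\<sigma>\<in>T. \<sigma> \<subset> outermost b T}, {\<sigma>\<in>T. \<sigma> \<inter> outermost b T = {}})"])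
  have ne: "\<sigma> \<noteq> {}" "\<sigma> \<noteq> {x}" if "\<sigma> \<in> B" for \<sigma> x
    using bspec[OF B that] by auto
  have bV: "{b} \<subset> V"
    using V by auto
  show "?f \<in> ?S \<rightarrow> nestings B V"
  proof safe
    fix \<tau> T1 T2 assume *: "\<tau> \<in> H" "T1 \<in> nestings B \<tau>" "T2 \<in> weak_nestings B (V - \<tau>)"
    then have "\<tau> \<subset> V" "b \<in> \<tau>"
      using bV by (auto simp: H_def)
    have "laminar ({\<tau>} \<inter> B \<union> T1 \<union> T2)"
      unfolding laminar_def
    proof (intro ballI)
      fix \<sigma> \<rho> assume "\<sigma> \<in> {\<tau>} \<inter> B \<union> T1 \<union> T2" "\<rho> \<in> {\<tau>} \<inter> B \<union> T1 \<union> T2"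
      then have "\<sigma> \<subseteq> \<tau> \<and> (\<sigma> = \<tau> \<or> \<sigma> \<in> T1) \<or> \<sigma> \<in> T2 \<and> \<sigma> \<inter> \<tau> = {}"
        "\<rho> \<subseteq> \<tau> \<and> (\<rho> = \<tau> \<or> \<rho> \<in> T1) \<or> \<rho> \<in> T2 \<and> \<rho> \<inter> \<tau> = {}"
        using * by (auto simp: nestings_def weak_nestings_def)
      moreover have "laminar T1" "laminar T2"
        using * by (auto simp: nestings_def weak_nestings_def)
      ultimately show "\<sigma> \<subseteq> \<rho> \<or> \<rho> \<subseteq> \<sigma> \<or> \<sigma> \<inter> \<rho> = {}"
        using laminarD[of T1 \<sigma> \<rho>] laminarD[of T2 \<sigma> \<rho>] by (elim disjE conjE) blast+
    qed
    moreover have "\<sigma> \<subset> V" if "\<sigma> \<in> T1" for \<sigma>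
      using that * \<open>\<tau> \<subset> V\<close> by (auto simp: nestings_def)
    moreover have "\<sigma> \<subset> V" if "\<sigma> \<in> T2" for \<sigma>
    proof -
      have "\<sigma> \<subseteq> V - \<tau>"
        using that * by (auto simp: weak_nestings_def)
      with \<open>b \<in> \<tau>\<close> V(2) show ?thesis by blast
    qed
    ultimately show "({\<tau>} \<inter> B) \<union> T1 \<union> T2 \<in> nestings B V"
      using * \<open>\<tau> \<subset> V\<close> unfolding nestings_def weak_nestings_def by simp blast
  qed
  show "(\<lambda>T. (outermost b T, {\<sigma>\<in>T. \<sigma> \<subset> outermost b T}, {\<sigma>\<in>T. \<sigma> \<inter> outermost b T = {}})) \<in> nestings B V \<rightarrow> ?S"
  proof
    fix T assume T: "T \<in> nestings B V"
    have "outermost b T \<in> H"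
      using outermost_cases[OF T V(1), of b] T by (auto simp: H_def nestings_def)
    then show "(outermost b T, {\<sigma>\<in>T. \<sigma> \<subset> outermost b T}, {\<sigma>\<in>T. \<sigma> \<inter> outermost b T = {}}) \<in> ?S"
      using T laminar_subset[of T]
      by (auto simp: nestings_def weak_nestings_def)
  qed
  show "(\<lambda>T. (outermost b T, {\<sigma>\<in>T. \<sigma> \<subset> outermost b T}, {\<sigma>\<in>T. \<sigma> \<inter> outermost b T = {}})) (?f x) = x"
    if x_in: "x \<in> ?S" for x
  proof -
    obtain \<tau> T1 T2 where x: "x = (\<tau>, T1, T2)" and
      *: "\<tau> \<in> H" "T1 \<in> nestings B \<tau>" "T2 \<in> weak_nestings B (V - \<tau>)"
      using x_in by (cases x) auto
    have "b \<in> \<tau>"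
      using * by (auto simp: H_def)
    have disj: "\<sigma> \<inter> \<tau> = {}" "\<sigma> \<noteq> {}" if "\<sigma> \<in> T2" for \<sigma>
      using that * ne by (auto simp: weak_nestings_def)
    have sub: "\<sigma> \<subset> \<tau>" "\<sigma> \<noteq> {}" if "\<sigma> \<in> T1" for \<sigma>
      using that * ne by (auto simp: nestings_def)
    let ?T = "({\<tau>} \<inter> B) \<union> T1 \<union> T2"
    have "\<tau> = {b} \<or> \<tau> \<in> B"
      using * by (auto simp: H_def)
    moreover have "\<sigma> \<subseteq> \<tau>" if "\<sigma> \<in> ?T" "b \<in> \<sigma>" for \<sigma>
      using that disj(1)[of \<sigma>] sub(1)[of \<sigma>] \<open>b \<in> \<tau>\<close> by auto
    ultimately have h: "outermost b ?T = \<tau>"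
      using \<open>b \<in> \<tau>\<close> by (auto simp: outermost_def)
    have "{\<sigma>\<in>?T. \<sigma> \<subset> \<tau>} = T1"
    proof (intro set_eqI iffI)
      fix \<sigma> assume "\<sigma> \<in> {\<sigma>\<in>?T. \<sigma> \<subset> \<tau>}"
      then show "\<sigma> \<in> T1" using disj[of \<sigma>] by auto
    qed (use sub in auto)
    moreover have "{\<sigma>\<in>?T. \<sigma> \<inter> \<tau> = {}} = T2"
    proof (intro set_eqI iffI)
      fix \<sigma> assume "\<sigma> \<in> {\<sigma>\<in>?T. \<sigma> \<inter> \<tau> = {}}"
      then show "\<sigma> \<in> T2" using sub[of \<sigma>] \<open>b \<in> \<tau>\<close> by auto
    qed (use disj in auto)
    ultimately show ?thesis
      using h x by simp
  qed
  show "?f ((\<lambda>T. (outermost b T, {\<sigma>\<in>T. \<sigma> \<subset> outermost b T}, {\<sigma>\<in>T. \<sigma> \<inter> outermost b T = {}})) T) = T"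
    if T: "T \<in> nestings B V" for T
  proof -
    have TB: "T \<subseteq> B" and lam: "laminar T"
      using T by (auto simp: nestings_def)
    have "outermost b T \<in> T" if "outermost b T \<in> B"
      using outermost_cases[OF T V(1), of b] that ne by auto
    moreover have "\<sigma> \<subseteq> outermost b T \<or> \<sigma> \<inter> outermost b T = {}" if "\<sigma> \<in> T" for \<sigma>
      using outermost_cases[OF T V(1), of b]
    proof
      assume "outermost b T \<in> T \<and> b \<in> outermost b T"
      with lam that have "\<sigma> \<subseteq> outermost b T \<or> outermost b T \<subseteq> \<sigma> \<or> \<sigma> \<inter> outermost b T = {}"
        by (auto simp: laminar_def)
      moreover have "\<sigma> \<subseteq> outermost b T" if "outermost b T \<subseteq> \<sigma>"
        using that \<open>outermost b T \<in> T \<and> b \<in> outermost b T\<close> \<open>\<sigma> \<in> T\<close> by (auto simp: outermost_def)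
      ultimately show ?thesis by blast
    qed (use that ne TB in auto)
    ultimately show ?thesis
      using TB by auto
  qed
qed

lemma weak_nestings_cases:
  assumes "V \<in> B"
  shows "weak_nestings B V = nestings B V \<union> insert V ` nestings B V"
proof (intro set_eqI iffI)
  fix T assume T: "T \<in> weak_nestings B V"
  show "T \<in> nestings B V \<union> insert V ` nestings B V"
  proof (cases "V \<in> T")
    case True
    have "T - {V} \<in> nestings B V"
      using T laminar_subset[of T "T - {V}"] by (auto simp: nestings_def weak_nestings_def)
    with True show ?thesis
      by (metis UnCI image_eqI insert_Diff)
  next
    case False
    with T show ?thesis by (auto simp: nestings_def weak_nestings_def)
  qed
next
  fix T assume "T \<in> nestings B V \<union> insert V ` nestings B V"
  then show "T \<in> weak_nestings B V"
    using assms by (auto simp: nestings_def weak_nestings_def laminar_def)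
qed

text \<open>Induction along the same decomposition: the outermost member \<open>\<tau>\<close> together with what is inside has fewer than
  \<open>card \<tau>\<close> members, the complement contributes fewer than \<open>card (V - \<tau>)\<close>, so at least two are lost
  when \<open>V\<close> itself is absent.\<close>

lemma card_weak_nesting:
  assumes B: "\<forall>\<sigma>\<in>B. 1 < card \<sigma>"
  shows "finite V \<Longrightarrow> V \<noteq> {} \<Longrightarrow> T \<in> weak_nestings B V \<Longrightarrow> card T < card V"
proof (induction "card V" arbitrary: V T rule: less_induct)
  case less
  have strict: "card U + 2 \<le> card V" if U: "U \<in> nestings B V" "1 < card V" for U
  proof -
    obtain b where b: "b \<in> V"
      using less.prems by blast
    have "U \<in> (\<lambda>(\<tau>, T1, T2). ({\<tau>} \<inter> B) \<union> T1 \<union> T2) `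
        (SIGMA \<tau>:insert {b} {\<sigma> \<in> B. b \<in> \<sigma> \<and> \<sigma> \<subset> V}. nestings B \<tau> \<times> weak_nestings B (V - \<tau>))"
      using bij_betw_imp_surj_on[OF nestings_outermost_bij[OF B less.prems(1) b U(2)]] U(1) by simp
    then obtain \<tau> T1 T2 where \<tau>: "\<tau> \<in> insert {b} {\<sigma> \<in> B. b \<in> \<sigma> \<and> \<sigma> \<subset> V}"
      and T12: "T1 \<in> nestings B \<tau>" "T2 \<in> weak_nestings B (V - \<tau>)" and UT: "U = ({\<tau>} \<inter> B) \<union> T1 \<union> T2"
      by (elim imageE SigmaE) simp
    have sub: "\<tau> \<subset> V" "\<tau> \<noteq> {}"
      using \<tau> b U(2) by auto
    then have fin: "finite \<tau>" "card \<tau> < card V"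
      using less.prems(1) by (auto intro: finite_subset psubset_card_mono)
    then have fin': "card (V - \<tau>) = card V - card \<tau>" "card (V - \<tau>) < card V" "V - \<tau> \<noteq> {}"
      using sub less.prems(1) by (auto simp: card_Diff_subset card_gt_0_iff psubset_imp_subset intro!: diff_less)
    have "({\<tau>} \<inter> B) \<union> T1 \<in> weak_nestings B \<tau>"
    proof -
      have "T1 \<subseteq> B" "laminar T1" "\<forall>\<sigma>\<in>T1. \<sigma> \<subseteq> \<tau>"
        using T12(1) by (auto simp: nestings_def)
      then show ?thesis
        using laminar_insert_top[of T1 \<tau>] by (cases "\<tau> \<in> B") (simp_all add: weak_nestings_def)
    qed
    then have "card (({\<tau>} \<inter> B) \<union> T1) < card \<tau>"
      by (rule less.hyps[OF fin(2,1) sub(2)])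
    moreover have "card T2 < card (V - \<tau>)"
      by (rule less.hyps[OF fin'(2) finite_Diff[OF less.prems(1)] fin'(3) T12(2)])
    moreover have "card U \<le> card (({\<tau>} \<inter> B) \<union> T1) + card T2"
      unfolding UT by (rule card_Un_le)
    ultimately show ?thesis
      using fin fin' by linarith
  qed
  show ?case
  proof (cases "1 < card V")
    case True
    show ?thesis
    proof (cases "V \<in> B")
      case True
      then obtain U where U: "U \<in> nestings B V" "T = U \<or> T = insert V U"
        using less.prems(3) weak_nestings_cases[OF True] by blast
      have "card T \<le> Suc (card U)"
        using U(2) card_insert_le_m1[of "Suc (card U)" U V] by auto
      then show ?thesis
        using strict[OF U(1) \<open>1 < card V\<close>] by simp
    next
      case False
      then have "T \<in> nestings B V"
        using less.prems(3) by (auto simp: nestings_def weak_nestings_def)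
      then show ?thesis
        using strict[of T] True by simp
    qed
  next
    case False
    have "T = {}"
    proof (rule equals0I)
      fix \<sigma> assume "\<sigma> \<in> T"
      then have "\<sigma> \<subseteq> V" "1 < card \<sigma>"
        using less.prems(3) B by (auto simp: weak_nestings_def)
      with False card_mono[OF less.prems(1), of \<sigma>] show False by simp
    qed
    then show ?thesis
      using less.prems by (simp add: card_gt_0_iff)
  qed
qed

text \<open>Adding \<open>V\<close> to the family, and to the set system, saves one in the previous bound.\<close>

lemma card_nesting:
  assumes B: "\<forall>\<sigma>\<in>B. 1 < card \<sigma>" and V: "finite V" "1 < card V" and T: "T \<in> nestings B V"
  shows "card T + 2 \<le> card V"
proof -
  have B': "\<forall>\<sigma>\<in>insert V B. 1 < card \<sigma>"
    using B V by auto
  have "insert V T \<in> weak_nestings (insert V B) V"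
    using T by (auto simp: nestings_def weak_nestings_def laminar_def)
  moreover have "V \<noteq> {}"
    using V by auto
  ultimately have "card (insert V T) < card V"
    using card_weak_nesting[OF B' V(1)] by blast
  moreover have "V \<notin> T" "finite T"
    using T V finite_nesting[OF T] by (auto simp: nestings_def)
  ultimately show ?thesis by simp
qed

lemma weak_nesting_poly_eq:
  assumes B: "\<forall>\<sigma>\<in>B. 1 < card \<sigma>" and V: "finite V" "V \<in> B"
  shows "weak_nesting_poly B y V = (1 + y) * nesting_poly B y V"
proof -
  note bound = card_nesting[OF B V(1) bspec[OF B V(2)]]
  have notin: "V \<notin> T" "finite T" if "T \<in> nestings B V" for T
    using that finite_nesting[OF that V(1)] by (auto simp: nestings_def)
  have inj: "inj_on (insert V) (nestings B V)"
    by (intro inj_onI) (simp add: insert_ident notin)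
  have "weak_nesting_poly B y V = (\<Sum>T\<in>nestings B V. y ^ (card V - 1 - card T)) +
      (\<Sum>T\<in>insert V ` nestings B V. y ^ (card V - 1 - card T))"
    unfolding weak_nesting_poly_def weak_nestings_cases[OF V(2)]
    using notin finite_nestings[OF V(1)] by (intro sum.union_disjoint) auto
  also have "(\<Sum>T\<in>insert V ` nestings B V. y ^ (card V - 1 - card T)) = nesting_poly B y V"
    unfolding nesting_poly_def sum.reindex[OF inj] o_def
    using notin by (intro sum.cong refl arg_cong[of _ _ "\<lambda>n. y ^ n"]) auto
  also have "(\<Sum>T\<in>nestings B V. y ^ (card V - 1 - card T)) = y * nesting_poly B y V"
    unfolding nesting_poly_def sum_distrib_left power_Suc [symmetric]
  proof (intro sum.cong refl arg_cong[of _ _ "\<lambda>n. y ^ n"])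
    fix T assume "T \<in> nestings B V"
    from bound[OF this] show "card V - 1 - card T = Suc (card V - 2 - card T)" by simp
  qed
  finally show ?thesis
    by (simp add: algebra_simps)
qed

lemma nestings_small:
  assumes B: "\<forall>\<sigma>\<in>B. 1 < card \<sigma>" and V: "card V \<le> 1" "finite V"
  shows "nestings B V = {{}}" "weak_nestings B V = {{}}"
proof -
  have none: "\<sigma> \<notin> B" if "\<sigma> \<subseteq> V" for \<sigma>
    using card_mono[OF V(2) that] V(1) bspec[OF B, of \<sigma>] by auto
  have "weak_nestings B V \<subseteq> {{}}"
  proof
    fix T assume "T \<in> weak_nestings B V"
    then have T: "T \<subseteq> B" "\<forall>\<sigma>\<in>T. \<sigma> \<subseteq> V"
      by (simp_all add: weak_nestings_def)
    have "\<sigma> \<notin> T" for \<sigma>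
      using T none[of \<sigma>] subsetD[OF T(1), of \<sigma>] bspec[OF T(2), of \<sigma>] by metis
    then show "T \<in> {{}}"
      by blast
  qed
  moreover have "nestings B V \<subseteq> weak_nestings B V"
    by (auto simp: nestings_def weak_nestings_def)
  moreover have "{} \<in> nestings B V"
    by (simp add: nestings_def laminar_def)
  ultimately show "nestings B V = {{}}" "weak_nestings B V = {{}}"
    by (blast intro: equalityI)+
qed

text \<open>The exponents have been chosen so that the decomposition at the outermost member is multiplicative,
  also in the degenerate case \<open>\<tau> = {b}\<close>.\<close>

lemma nesting_poly_rec:
  fixes B :: "'a set set"
  assumes B: "\<forall>\<sigma>\<in>B. 1 < card \<sigma>"
    and V: "finite V" "b \<in> V" "1 < card V"
  shows "nesting_poly B y V =
    (\<Sum>\<tau> \<in> insert {b} {\<sigma> \<in> B. b \<in> \<sigma> \<and> \<sigma> \<subset> V}. nesting_poly B y \<tau> * weak_nesting_poly B y (V - \<tau>))"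
proof -
  let ?H = "insert {b} {\<sigma> \<in> B. b \<in> \<sigma> \<and> \<sigma> \<subset> V}"
  have sub: "\<tau> \<subset> V" "finite \<tau>" "b \<in> \<tau>" if "\<tau> \<in> ?H" for \<tau>
  proof -
    have "{b} \<subset> V"
      using V by auto
    then show "\<tau> \<subset> V" "b \<in> \<tau>"
      using that by auto
    then show "finite \<tau>"
      by (intro finite_subset[OF psubset_imp_subset V(1)])
  qed
  have finH: "finite ?H"
    by (rule finite_subset[of _ "insert {b} (Pow V)"]) (auto simp: V(1))
  have "nesting_poly B y V = (\<Sum>(\<tau>, T1, T2) \<in> (SIGMA \<tau>:?H. nestings B \<tau> \<times> weak_nestings B (V - \<tau>)).
      y ^ (card V - 2 - card (({\<tau>} \<inter> B) \<union> T1 \<union> T2)))"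
    unfolding nesting_poly_def
    by (subst sum.reindex_bij_betw[OF nestings_outermost_bij[OF B V], symmetric])
      (simp add: case_prod_beta)
  also have "\<dots> = (\<Sum>\<tau>\<in>?H. \<Sum>(T1, T2)\<in>nestings B \<tau> \<times> weak_nestings B (V - \<tau>).
      y ^ (card V - 2 - card (({\<tau>} \<inter> B) \<union> T1 \<union> T2)))"
    by (intro sum.Sigma[symmetric] finH ballI finite_cartesian_product finite_nestings
        finite_weak_nestings finite_Diff sub V)
  also have "\<dots> = (\<Sum>\<tau>\<in>?H. \<Sum>(T1, T2)\<in>nestings B \<tau> \<times> weak_nestings B (V - \<tau>).
      y ^ (card \<tau> - 2 - card T1) * y ^ (card (V - \<tau>) - 1 - card T2))"
  proof (intro sum.cong refl, clarify)
    fix \<tau> T1 T2 assume \<tau>: "\<tau> \<in> ?H" and T: "T1 \<in> nestings B \<tau>" "T2 \<in> weak_nestings B (V - \<tau>)"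
    note \<tau>V = sub[OF \<tau>]
    have fin: "finite T1" "finite T2"
      using finite_nesting[OF T(1) \<tau>V(2)] finite_weak_nesting[OF T(2) finite_Diff[OF V(1)]] by simp_all
    have T2: "card T2 < card (V - \<tau>)"
      using card_weak_nesting[OF B finite_Diff[OF V(1)] _ T(2)] \<tau>V(1) by blast
    have cV: "card V = card \<tau> + card (V - \<tau>)"
      using \<tau>V V card_mono[OF V(1), of \<tau>] by (simp add: card_Diff_subset psubset_imp_subset)
    have "T1 \<inter> T2 = {}"
    proof (rule ccontr)
      assume "T1 \<inter> T2 \<noteq> {}"
      then obtain \<sigma> where "\<sigma> \<in> T1" "\<sigma> \<in> T2" by blast
      then have "\<sigma> \<subseteq> \<tau>" "\<sigma> \<subseteq> V - \<tau>" "\<sigma> \<in> B"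
        using T by (auto simp: nestings_def weak_nestings_def)
      then have "\<sigma> = {}" by blast
      with bspec[OF B \<open>\<sigma> \<in> B\<close>] show False by simp
    qed
    then have c12: "card (T1 \<union> T2) = card T1 + card T2"
      using fin by (simp add: card_Un_disjoint)
    have \<tau>nin: "\<tau> \<notin> T1 \<union> T2"
      using T \<tau>V by (auto simp: nestings_def weak_nestings_def)
    have "card V - 2 - card (({\<tau>} \<inter> B) \<union> T1 \<union> T2) = (card \<tau> - 2 - card T1) + (card (V - \<tau>) - 1 - card T2)"
    proof (cases "\<tau> \<in> B")
      case True
      have "({\<tau>} \<inter> B) \<union> T1 \<union> T2 = insert \<tau> (T1 \<union> T2)"
        using True by auto
      then have "card (({\<tau>} \<inter> B) \<union> T1 \<union> T2) = Suc (card T1 + card T2)"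
        using \<tau>nin fin c12 by simp
      moreover have "card T1 + 2 \<le> card \<tau>"
        using card_nesting[OF B \<tau>V(2) bspec[OF B True] T(1)] .
      ultimately show ?thesis
        using T2 cV by linarith
    next
      case False
      then have "\<tau> = {b}" using \<tau> by blast
      moreover from this have "T1 = {}"
        using T(1) nestings_small(1)[OF B, of "{b}"] by auto
      moreover have "({\<tau>} \<inter> B) \<union> T1 \<union> T2 = T2"
        using False \<open>T1 = {}\<close> by blast
      ultimately show ?thesis
        using T2 cV by simp
    qed
    then show "y ^ (card V - 2 - card (({\<tau>} \<inter> B) \<union> T1 \<union> T2)) =
        y ^ (card \<tau> - 2 - card T1) * y ^ (card (V - \<tau>) - 1 - card T2)"
      by (simp add: power_add)
  qed
  also have "\<dots> = (\<Sum>\<tau>\<in>?H. nesting_poly B y \<tau> * weak_nesting_poly B y (V - \<tau>))"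
    unfolding nesting_poly_def weak_nesting_poly_def sum_product sum.cartesian_product ..
  finally show ?thesis .
qed

section \<open>Tubings of brooms\<close>

definition broom_set :: "nat \<Rightarrow> nat \<Rightarrow> nat set \<Rightarrow> (nat + nat) set" where
  "broom_set a b S = Inl ` {a..b} \<union> Inr ` S"

text \<open>The tubes of all brooms with top \<open>Inl n\<close>. The number of leaves is left open: it is fixed by the
  ambient set when nestings are formed, so that tubes with different leaves can be compared.\<close>

definition broom_tubes :: "nat \<Rightarrow> (nat + nat) set set" where
  "broom_tubes n = {\<sigma>. 1 < card \<sigma> \<and>
     (\<exists>a b S. \<sigma> = broom_set a b S \<and> a \<le> b \<and> b \<le> n \<and> finite S \<and> (S = {} \<or> b = n))}"

lemma Inl_in_broom_set [simp]: "Inl i \<in> broom_set a b S \<longleftrightarrow> a \<le> i \<and> i \<le> b"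
  by (auto simp: broom_set_def)

lemma Inr_in_broom_set [simp]: "Inr j \<in> broom_set a b S \<longleftrightarrow> j \<in> S"
  by (auto simp: broom_set_def)

lemma finite_broom_set [simp]: "finite S \<Longrightarrow> finite (broom_set a b S)"
  by (simp add: broom_set_def)

lemma card_broom_set: "finite S \<Longrightarrow> card (broom_set a b S) = (Suc b - a) + card S"
  unfolding broom_set_def
  by (subst card_Un_disjoint) (auto simp: card_image)

lemma broom_set_subset_iff:
  assumes "a \<le> b"
  shows "broom_set a b S \<subseteq> broom_set c d R \<longleftrightarrow> c \<le> a \<and> b \<le> d \<and> S \<subseteq> R"
proof
  assume sub: "broom_set a b S \<subseteq> broom_set c d R"
  have "c \<le> a" "b \<le> d"
    using subsetD[OF sub, of "Inl a"] subsetD[OF sub, of "Inl b"] assms by simp_all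
  moreover have "j \<in> R" if "j \<in> S" for j
    using subsetD[OF sub, of "Inr j"] that by simp
  ultimately show "c \<le> a \<and> b \<le> d \<and> S \<subseteq> R" by auto
qed (auto simp: broom_set_def)

lemma broom_set_eq_iff:
  assumes "a \<le> b" "c \<le> d"
  shows "broom_set a b S = broom_set c d R \<longleftrightarrow> a = c \<and> b = d \<and> S = R"
  using broom_set_subset_iff[OF assms(1), of S c d R] broom_set_subset_iff[OF assms(2), of R a b S]
  by auto

lemma Field_broom_eq: "Field (broom n k) = broom_set 0 n {..<k}"
  unfolding Field_broom broom_set_def Plus_def by (simp add: atLeast0AtMost lessThan_Suc_atMost)

lemma broom_iff [simp]:
  "(Inl i, Inl j) \<in> broom n k \<longleftrightarrow> i \<le> j \<and> j \<le> n"
  "(Inl i, Inr l) \<in> broom n k \<longleftrightarrow> i \<le> n \<and> l < k"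
  "(Inr l, Inr m) \<in> broom n k \<longleftrightarrow> l = m \<and> l < k"
  "(Inr l, Inl j) \<notin> broom n k"
  by (auto simp: broom_def ordinal_sum_def Field_chain Field_antichain)
    (auto simp: chain_def antichain_def)

lemma card_broom_tubes: "\<forall>\<sigma>\<in>broom_tubes n. 1 < card \<sigma>"
  by (simp add: broom_tubes_def)

lemma broom_tubesE:
  assumes "\<sigma> \<in> broom_tubes n"
  obtains a b S where "\<sigma> = broom_set a b S" "a \<le> b" "b \<le> n" "finite S" "S = {} \<or> b = n"
  using assms unfolding broom_tubes_def by auto

lemma broom_set_in_broom_tubes_iff:
  assumes "a \<le> b" "finite S"
  shows "broom_set a b S \<in> broom_tubes n \<longleftrightarrow> (a < b \<or> S \<noteq> {}) \<and> b \<le> n \<and> (S = {} \<or> b = n)"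
proof -
  have "1 < card (broom_set a b S) \<longleftrightarrow> a < b \<or> S \<noteq> {}"
    using assms card_gt_0_iff[of S] by (cases "S = {}") (auto simp: card_broom_set)
  moreover have "(\<exists>c d R. broom_set a b S = broom_set c d R \<and> c \<le> d \<and> d \<le> n \<and> finite R \<and> (R = {} \<or> d = n))
      \<longleftrightarrow> b \<le> n \<and> (S = {} \<or> b = n)"
  proof
    assume "\<exists>c d R. broom_set a b S = broom_set c d R \<and> c \<le> d \<and> d \<le> n \<and> finite R \<and> (R = {} \<or> d = n)"
    then obtain c d R where "broom_set a b S = broom_set c d R" "c \<le> d" "d \<le> n" "R = {} \<or> d = n"
      by blast
    then show "b \<le> n \<and> (S = {} \<or> b = n)"
      using broom_set_eq_iff[OF assms(1), of c d S R] by simp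
  next
    assume "b \<le> n \<and> (S = {} \<or> b = n)"
    then show "\<exists>c d R. broom_set a b S = broom_set c d R \<and> c \<le> d \<and> d \<le> n \<and> finite R \<and> (R = {} \<or> d = n)"
      using assms by (intro exI[of _ a] exI[of _ b] exI[of _ S]) simp
  qed
  ultimately show ?thesis
    unfolding broom_tubes_def by simp
qed

lemma covers_broom_Inr:
  assumes "(x, Inr l) \<in> covers (broom n k)"
  shows "x = Inl n"
proof (cases x)
  case (Inl i)
  have "(Inl i, Inl n) \<in> broom n k" "(Inl n, Inr l) \<in> broom n k"
    using assms Inl by (auto simp: covers_def)
  moreover have "(Inl i, z) \<in> broom n k \<and> (z, Inr l) \<in> broom n k \<Longrightarrow> z = Inl i \<or> z = Inr l" for z
    using assms Inl by (simp add: covers_def)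
  ultimately show ?thesis
    using Inl by fastforce
next
  case (Inr j)
  with assms show ?thesis by (auto simp: covers_def)
qed

lemma broom_tubes_imp_tube:
  assumes \<sigma>: "\<sigma> \<in> broom_tubes n" "\<sigma> \<subseteq> Field (broom n k)"
  shows "tube (broom n k) \<sigma>"
proof -
  obtain a b S where \<sigma>_eq: "\<sigma> = broom_set a b S" and ab: "a \<le> b" "b \<le> n" "S = {} \<or> b = n"
    using \<sigma>(1) by (rule broom_tubesE)
  have S: "S \<subseteq> {..<k}"
    using \<sigma>(2) ab unfolding \<sigma>_eq Field_broom_eq by (simp add: broom_set_subset_iff)
  have "order_convex (broom n k) \<sigma>"
    unfolding order_convex_def
  proof (intro ballI allI impI)
    fix x z y assume "x \<in> \<sigma>" "z \<in> \<sigma>" "(x, y) \<in> broom n k \<and> (y, z) \<in> broom n k"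
    then show "y \<in> \<sigma>"
      using ab unfolding \<sigma>_eq by (cases x; cases y; cases z) auto
  qed
  moreover have "hasse_connected (broom n k) \<sigma>"
  proof -
    define E where "E = (covers (broom n k) \<union> (covers (broom n k))\<inverse>) \<inter> \<sigma> \<times> \<sigma>"
    have "sym E"
      by (auto simp: E_def sym_def)
    have up: "(Inl i, Inl (Suc i)) \<in> E" if "a \<le> i" "Suc i \<le> b" for i
    proof -
      have "z = Inl i \<or> z = Inl (Suc i)" if "(Inl i, z) \<in> broom n k" "(z, Inl (Suc i)) \<in> broom n k" for z
        using that by (cases z) auto
      then show ?thesis
        using that ab by (auto simp: E_def covers_def \<sigma>_eq)
    qed
    have leaf: "(Inl b, Inr j) \<in> E" if "j \<in> S" for j
    proof -
      have "z = Inl b \<or> z = Inr j" if "(Inl b, z) \<in> broom n k" "(z, Inr j) \<in> broom n k" for z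
        using that ab \<open>j \<in> S\<close> by (cases z) auto
      then show ?thesis
        using that ab S by (auto simp: E_def covers_def \<sigma>_eq)
    qed
    have chain: "(Inl a, Inl (a + i)) \<in> E\<^sup>*" if "a + i \<le> b" for i
      using that
    proof (induction i)
      case (Suc i)
      then show ?case
        using up[of "a + i"] by (simp add: rtrancl_into_rtrancl)
    qed simp
    have from_a: "(Inl a, x) \<in> E\<^sup>*" if "x \<in> \<sigma>" for x
    proof (cases x)
      case (Inl i)
      then show ?thesis
        using that chain[of "i - a"] by (simp add: \<sigma>_eq)
    next
      case (Inr j)
      then show ?thesis
        using that chain[of "b - a"] leaf[of j] ab by (simp add: \<sigma>_eq rtrancl_into_rtrancl)
    qed
    have "(x, y) \<in> E\<^sup>*" if "x \<in> \<sigma>" "y \<in> \<sigma>" for x y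
      using from_a[OF that(1)] from_a[OF that(2)] sym_rtrancl[OF \<open>sym E\<close>]
      by (meson rtrancl_trans symD)
    then show ?thesis
      by (simp add: hasse_connected_def E_def)
  qed
  ultimately show ?thesis
    using \<sigma>(2) by (simp add: tube_def)
qed

text \<open>Convexity makes the chain part an interval. Connectedness forces a tube with a leaf and another
  element through the top of the chain.\<close>

lemma tube_imp_broom_tubes:
  assumes \<sigma>: "tube (broom n k) \<sigma>" "1 < card \<sigma>"
  shows "\<sigma> \<in> broom_tubes n"
proof -
  have sub: "\<sigma> \<subseteq> Field (broom n k)" and conn: "hasse_connected (broom n k) \<sigma>"
    and conv: "order_convex (broom n k) \<sigma>"
    using \<sigma>(1) by (auto simp: tube_def)
  define A where "A = {i. Inl i \<in> \<sigma>}"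
  define S where "S = {j. Inr j \<in> \<sigma>}"
  have fin: "finite A" "finite S" and An: "\<And>i. i \<in> A \<Longrightarrow> i \<le> n"
  proof -
    have "A \<subseteq> {..n}" "S \<subseteq> {..<k}"
      using sub by (auto simp: A_def S_def Field_broom_eq)
    then show "finite A" "finite S" "\<And>i. i \<in> A \<Longrightarrow> i \<le> n"
      by (auto intro: finite_subset)
  qed
  have \<sigma>_eq: "\<sigma> = Inl ` A \<union> Inr ` S"
  proof (intro set_eqI)
    fix x show "x \<in> \<sigma> \<longleftrightarrow> x \<in> Inl ` A \<union> Inr ` S"
      by (cases x) (auto simp: A_def S_def)
  qed
  \<comment> \<open>A leaf of the tube has a Hasse neighbour inside the tube, and its only Hasse neighbour is the top of the chain.\<close>
  have nA: "n \<in> A" if "j \<in> S" for j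
  proof -
    have "\<exists>y\<in>\<sigma>. y \<noteq> Inr j"
    proof (rule ccontr)
      assume "\<not> ?thesis"
      then have "\<sigma> \<subseteq> {Inr j}" by auto
      then show False
        using \<sigma>(2) card_mono[of "{Inr j}" \<sigma>] by simp
    qed
    then obtain y where y: "y \<in> \<sigma>" "y \<noteq> Inr j" by auto
    have "(Inr j, y) \<in> ((covers (broom n k) \<union> (covers (broom n k))\<inverse>) \<inter> \<sigma> \<times> \<sigma>)\<^sup>*"
      using conn y that by (auto simp: hasse_connected_def S_def)
    then obtain z where "(Inr j, z) \<in> (covers (broom n k) \<union> (covers (broom n k))\<inverse>) \<inter> \<sigma> \<times> \<sigma>"
      using y(2) by (auto elim: converse_rtranclE)
    moreover have "(Inr j, z) \<notin> covers (broom n k)"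
      by (cases z) (auto simp: covers_def)
    ultimately have "z = Inl n" "z \<in> \<sigma>"
      using covers_broom_Inr by auto
    then show ?thesis
      by (simp add: A_def)
  qed
  have "A \<noteq> {}"
  proof
    assume "A = {}"
    with nA have "S = {}" by auto
    with \<open>A = {}\<close> \<sigma>_eq \<sigma>(2) show False by simp
  qed
  define a where "a = Min A"
  define b where "b = Max A"
  have ab: "a \<in> A" "b \<in> A" "\<And>i. i \<in> A \<Longrightarrow> a \<le> i \<and> i \<le> b"
    using fin \<open>A \<noteq> {}\<close> by (auto simp: a_def b_def)
  have interval: "i \<in> A" if "a \<le> i" "i \<le> b" for i
  proof -
    have "(Inl a, Inl i) \<in> broom n k \<and> (Inl i, Inl b) \<in> broom n k"
      using that An[OF ab(2)] by auto
    moreover have "Inl a \<in> \<sigma>" "Inl b \<in> \<sigma>"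
      using ab by (auto simp: A_def)
    ultimately show ?thesis
      using conv unfolding order_convex_def A_def by blast
  qed
  have "A = {a..b}"
  proof (intro equalityI subsetI)
    fix i assume "i \<in> A"
    from ab(3)[OF this] show "i \<in> {a..b}" by simp
  next
    fix i assume "i \<in> {a..b}"
    then show "i \<in> A" by (intro interval) simp_all
  qed
  then have "\<sigma> = broom_set a b S"
    unfolding broom_set_def using \<sigma>_eq by simp
  moreover have "b = n" if "S \<noteq> {}"
  proof -
    obtain j where "j \<in> S"
      using \<open>S \<noteq> {}\<close> by blast
    from ab(3)[OF nA[OF this]] An[OF ab(2)] show ?thesis by simp
  qed
  moreover have "a \<le> b" "b \<le> n"
    using ab(3)[OF ab(1)] An[OF ab(2)] by simp_all
  ultimately show ?thesis
    using \<sigma>(2) fin(2) unfolding broom_tubes_def by blast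
qed

text \<open>Along \<open>tube_less\<close> the least chain element strictly increases: if \<open>\<tau>\<close> is disjoint from \<open>\<sigma>\<close> and does
  not start above it, then the chain part of \<open>\<tau>\<close> ends before \<open>\<sigma>\<close> starts, so \<open>\<tau>\<close> contains no
  leaf and no element of \<open>\<sigma>\<close> lies below an element of \<open>\<tau>\<close>.\<close>

lemma acyclic_tube_less_broom:
  assumes T: "T \<subseteq> broom_tubes n"
  shows "acyclic {(\<sigma>, \<tau>). \<sigma> \<in> T \<and> \<tau> \<in> T \<and> tube_less (broom n k) \<sigma> \<tau>}"
proof -
  let ?m = "\<lambda>\<sigma> :: (nat + nat) set. LEAST i. Inl i \<in> \<sigma>"
  have m: "?m (broom_set a b S) = a" if "a \<le> b" for a b S
    using that by (intro Least_equality) auto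
  have "?m \<sigma> < ?m \<tau>" if \<sigma>T: "\<sigma> \<in> T" "\<tau> \<in> T" and less: "tube_less (broom n k) \<sigma> \<tau>" for \<sigma> \<tau>
  proof -
    have "\<sigma> \<in> broom_tubes n" "\<tau> \<in> broom_tubes n"
      using \<sigma>T T by auto
    then obtain a b S c d R where \<sigma>: "\<sigma> = broom_set a b S" "a \<le> b" "b \<le> n"
      and \<tau>: "\<tau> = broom_set c d R" "c \<le> d" "d \<le> n" "R = {} \<or> d = n"
      by (elim broom_tubesE) blast
    obtain x y where xy: "x \<in> \<sigma>" "y \<in> \<tau>" "(x, y) \<in> broom n k" and disj: "\<sigma> \<inter> \<tau> = {}"
      using less by (auto simp: tube_less_def)
    have "\<not> c \<le> a"
    proof
      assume "c \<le> a"
      have "Inl a \<in> \<sigma>" using \<sigma> by simp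
      then have "d < a"
        using disj \<tau> \<open>c \<le> a\<close> by (metis Inl_in_broom_set disjoint_iff not_le)
      then show False
        using xy \<sigma> \<tau> disj by (cases x; cases y) auto
    qed
    then show ?thesis
      using m[OF \<sigma>(2)] m[OF \<tau>(2)] \<sigma> \<tau> by simp
  qed
  then have "{(\<sigma>, \<tau>). \<sigma> \<in> T \<and> \<tau> \<in> T \<and> tube_less (broom n k) \<sigma> \<tau>} \<subseteq> Wellfounded.measure ?m"
    by auto
  then show ?thesis
    by (intro wf_acyclic wf_subset[OF wf_measure])
qed

text \<open>This removes the acyclicity condition and the ambient poset from the count.\<close>

lemma tubing_broom_iff: "tubing (broom n k) T \<longleftrightarrow> T \<in> nestings (broom_tubes n) (Field (broom n k))"
proof -
  have finF: "finite (Field (broom n k))"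
    by (simp add: Field_broom_eq)
  have proper: "proper_tube (broom n k) \<sigma> \<longleftrightarrow> \<sigma> \<in> broom_tubes n \<and> \<sigma> \<subset> Field (broom n k)" for \<sigma>
  proof
    assume \<sigma>: "proper_tube (broom n k) \<sigma>"
    then have "\<sigma> \<in> broom_tubes n" "\<sigma> \<subseteq> Field (broom n k)" "\<sigma> \<noteq> Field (broom n k)"
      using tube_imp_broom_tubes by (auto simp: proper_tube_def tube_def)
    then show "\<sigma> \<in> broom_tubes n \<and> \<sigma> \<subset> Field (broom n k)" by auto
  next
    assume \<sigma>: "\<sigma> \<in> broom_tubes n \<and> \<sigma> \<subset> Field (broom n k)"
    then show "proper_tube (broom n k) \<sigma>"
      using broom_tubes_imp_tube[of \<sigma> n k] psubset_card_mono[OF finF, of \<sigma>] card_broom_tubes[of n]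
      by (auto simp: proper_tube_def)
  qed
  have "T \<in> nestings (broom_tubes n) (Field (broom n k)) \<longleftrightarrow>
      (\<forall>\<sigma>\<in>T. proper_tube (broom n k) \<sigma>) \<and> laminar T"
    unfolding proper nestings_def by auto
  then show ?thesis
    using acyclic_tube_less_broom[of T n k] unfolding tubing_def laminar_def
    by (auto simp: nestings_def)
qed

definition broom_poly :: "nat \<Rightarrow> nat \<Rightarrow> 'r::comm_ring_1 \<Rightarrow> 'r" where
  "broom_poly n k y = nesting_poly (broom_tubes n) y (broom_set 0 n {..<k})"

lemma of_int_poly_tubing_f_poly_broom:
  assumes "n + k \<ge> 1"
  shows "of_int (poly (tubing_f_poly (broom n k)) y) = broom_poly n k (of_int y)"
proof -
  let ?N = "nestings (broom_tubes n) (Field (broom n k))"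
  let ?d = "n + k - 1"
  have card: "card (Field (broom n k)) = n + k + 1" and fin: "finite (Field (broom n k))"
    by (simp add: card_Field_broom) (simp add: Field_broom_eq)
  have d: "card (Field (broom n k)) - 2 = ?d"
    unfolding card by simp
  have fN: "finite ?N"
    using fin by (rule finite_nestings)
  have le: "card T \<le> ?d" if "T \<in> ?N" for T
  proof -
    have "1 < card (Field (broom n k))"
      using card assms by linarith
    from card_nesting[OF card_broom_tubes fin this that] card show ?thesis
      by simp
  qed
  have "poly (tubing_f_poly (broom n k)) y = (\<Sum>i\<le>?d. \<Sum>T\<in>{T\<in>?N. ?d - card T = i}. y ^ (?d - card T))"
    unfolding tubing_f_poly_def d poly_sum
  proof (intro sum.cong refl)
    fix i assume "i \<in> {..?d}"
    have "tubing (broom n k) T \<and> card T + i = ?d \<longleftrightarrow> T \<in> ?N \<and> ?d - card T = i" for T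
      using le[of T] unfolding tubing_broom_iff by auto
    then have "{T. tubing (broom n k) T \<and> card T + i = ?d} = {T\<in>?N. ?d - card T = i}"
      by blast
    then show "poly (monom (int (card {T. tubing (broom n k) T \<and> card T + i = ?d})) i) y =
        (\<Sum>T\<in>{T\<in>?N. ?d - card T = i}. y ^ (?d - card T))"
      by (simp add: poly_monom)
  qed
  also have "\<dots> = (\<Sum>T\<in>?N. y ^ (?d - card T))"
    using fN by (intro sum.group) auto
  finally show ?thesis
    unfolding broom_poly_def nesting_poly_def Field_broom_eq [symmetric] d by simp
qed

section \<open>Splitting at the outermost tube through the top of the chain\<close>

lemma sum_Pow_card:
  fixes f :: "nat \<Rightarrow> 'r::comm_semiring_1"
  assumes "finite S"
  shows "(\<Sum>R\<in>Pow S. f (card R)) = (\<Sum>j\<le>card S. of_nat (card S choose j) * f j)"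
proof -
  have "(\<Sum>R\<in>Pow S. f (card R)) = (\<Sum>j\<le>card S. \<Sum>R\<in>{R \<in> Pow S. card R = j}. f (card R))"
    using assms by (intro sum.group[symmetric]) (auto intro: card_mono)
  also have "\<dots> = (\<Sum>j\<le>card S. of_nat (card S choose j) * f j)"
  proof (intro sum.cong refl)
    fix j
    have "(\<Sum>R\<in>{R \<in> Pow S. card R = j}. f (card R)) = (\<Sum>R\<in>{R. R \<subseteq> S \<and> card R = j}. f j)"
      by (intro sum.cong) auto
    then show "(\<Sum>R\<in>{R \<in> Pow S. card R = j}. f (card R)) = of_nat (card S choose j) * f j"
      using n_subsets[OF assms, of j] by simp
  qed
  finally show ?thesis .
qed

text \<open>The contribution of the complement of an outermost tube, which consists of \<open>g\<close> chain elements and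
  \<open>m\<close> leaves, when \<open>p\<close> gives the polynomials of the chains. Leaves outside the tube lie in no
  subtube and only raise the exponent; a chain piece with at least two elements may itself be a
  tube or not, which is the factor \<open>1 + y\<close>. For \<open>g = m = 0\<close> the complement would be empty; the value \<open>0\<close>
  makes that term harmless in convolution sums.\<close>

definition gap_weight :: "(nat \<Rightarrow> 'r) \<Rightarrow> 'r \<Rightarrow> nat \<Rightarrow> nat \<Rightarrow> 'r::comm_ring_1" where
  "gap_weight p y g m =
     (if g = 0 then if m = 0 then 0 else y ^ (m - 1)
      else y ^ m * (if g = 1 then 1 else (1 + y) * p (g - 1)))"

lemma weak_nesting_poly_gap:
  assumes a: "a \<le> c" "c \<le> n" "finite R" and ne: "a < c \<or> R \<noteq> {}"
    and p: "\<And>g. 1 < g \<Longrightarrow> a + g = c \<Longrightarrow> nesting_poly (broom_tubes n) y (broom_set a (c - 1) {}) = p (g - 1)"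
  shows "weak_nesting_poly (broom_tubes n) y (Inl ` {a..<c} \<union> Inr ` R) = gap_weight p y (c - a) (card R)"
proof -
  let ?B = "broom_tubes n"
  let ?I = "Inl ` {a..<c} :: (nat + nat) set"
  have sub: "\<sigma> \<subseteq> ?I" if \<sigma>: "\<sigma> \<in> ?B" "\<sigma> \<subseteq> ?I \<union> Inr ` R" for \<sigma>
  proof -
    obtain e d S where e: "\<sigma> = broom_set e d S" "e \<le> d" "S = {} \<or> d = n"
      using \<sigma>(1) by (rule broom_tubesE)
    then have "d < c"
      using subsetD[OF \<sigma>(2), of "Inl d"] by auto
    then have "S = {}"
      using e(3) a(2) by auto
    then have "\<sigma> = Inl ` {e..d}"
      using e(1) by (simp add: broom_set_def)
    then show ?thesis
      using \<sigma>(2) by auto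
  qed
  have wn: "weak_nestings ?B (?I \<union> Inr ` R) = weak_nestings ?B ?I"
  proof (intro equalityI subsetI)
    fix T assume T: "T \<in> weak_nestings ?B (?I \<union> Inr ` R)"
    then have "\<sigma> \<subseteq> ?I" if "\<sigma> \<in> T" for \<sigma>
      using that by (intro sub) (auto simp: weak_nestings_def)
    with T show "T \<in> weak_nestings ?B ?I"
      by (simp add: weak_nestings_def)
  qed (auto simp: weak_nestings_def)
  have "card (?I \<union> Inr ` R) = card ?I + card (Inr ` R :: (nat + nat) set)"
    using a(3) by (intro card_Un_disjoint) auto
  then have card: "card (?I \<union> Inr ` R) = (c - a) + card R"
    by (simp add: card_image)
  show ?thesis
  proof (cases "a = c")
    case True
    have "weak_nestings ?B ?I = {{}}"
      using True by (intro nestings_small(2)[OF card_broom_tubes]) auto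
    then show ?thesis
      using True ne a(3) unfolding weak_nesting_poly_def wn card by (simp add: gap_weight_def)
  next
    case False
    then have I: "?I \<noteq> {}" "finite ?I" "card ?I = c - a"
      using a(1) by (auto simp: card_image)
    have exponent: "(c - a) + card R - 1 - card T = card R + ((c - a) - 1 - card T)"
      if "T \<in> weak_nestings ?B ?I" for T
      using card_weak_nesting[OF card_broom_tubes I(2,1) that] I(3) by simp
    have "weak_nesting_poly ?B y (?I \<union> Inr ` R) = y ^ card R * weak_nesting_poly ?B y ?I"
      unfolding weak_nesting_poly_def wn card I(3) sum_distrib_left
      by (intro sum.cong refl arg_cong[of _ _ "\<lambda>m. y ^ m"] trans[OF _ power_add] exponent)
    also have "weak_nesting_poly ?B y ?I = (if c - a = 1 then 1 else (1 + y) * p (c - a - 1))"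
    proof (cases "c - a = 1")
      case True
      then have "weak_nestings ?B ?I = {{}}"
        using I by (intro nestings_small(2)[OF card_broom_tubes]) auto
      then show ?thesis
        using True I by (simp add: weak_nesting_poly_def)
    next
      case g: False
      have eq: "?I = broom_set a (c - 1) {}"
        using False a(1) by (auto simp: broom_set_def)
      then have "?I \<in> ?B"
        using g False a broom_set_in_broom_tubes_iff[of a "c - 1" "{}" n] by fastforce
      then show ?thesis
        using weak_nesting_poly_eq[OF card_broom_tubes I(2), where y = y] g False a(1) p[of "c - a"] eq by simp
    qed
    finally show ?thesis
      using False a(1) by (simp add: gap_weight_def)
  qed
qed

text \<open>The possible outermost members through the top \<open>Inl b\<close> are the \<open>broom_set c b R\<close> other than the whole
  set, the degenerate value \<open>{Inl b}\<close> being \<open>broom_set b b {}\<close>.\<close>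

lemma nesting_poly_broom_set_rec:
  assumes ab: "a \<le> b" "b \<le> n" and S: "finite S" "S = {} \<or> b = n" and ne: "a < b \<or> S \<noteq> {}"
  shows "nesting_poly (broom_tubes n) y (broom_set a b S) =
    (\<Sum>(c, R)\<in>{a..b} \<times> Pow S - {(a, S)}. nesting_poly (broom_tubes n) y (broom_set c b R) *
        weak_nesting_poly (broom_tubes n) y (Inl ` {a..<c} \<union> Inr ` (S - R)))"
proof -
  let ?B = "broom_tubes n" and ?V = "broom_set a b S"
  let ?D = "{a..b} \<times> Pow S - {(a, S)}"
  have inj: "inj_on (\<lambda>(c, R). broom_set c b R) ?D"
    by (intro inj_onI) (auto simp: broom_set_eq_iff)
  have outermost_eq: "insert {Inl b} {\<sigma> \<in> ?B. Inl b \<in> \<sigma> \<and> \<sigma> \<subset> ?V} = (\<lambda>(c, R). broom_set c b R) ` ?D"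
  proof (intro equalityI subsetI)
    fix \<sigma> assume "\<sigma> \<in> insert {Inl b} {\<sigma> \<in> ?B. Inl b \<in> \<sigma> \<and> \<sigma> \<subset> ?V}"
    then consider "\<sigma> = {Inl b}" | "\<sigma> \<in> ?B" "Inl b \<in> \<sigma>" "\<sigma> \<subset> ?V"
      by blast
    then obtain c R where "\<sigma> = broom_set c b R" "(c, R) \<in> ?D"
    proof cases
      case 1
      then have "\<sigma> = broom_set b b {}"
        by (simp add: broom_set_def)
      then show ?thesis
        using that[of b "{}"] ab ne by auto
    next
      case 2
      obtain c d R where c: "\<sigma> = broom_set c d R" "c \<le> d"
        using 2(1) by (rule broom_tubesE)
      have sub: "broom_set c d R \<subseteq> broom_set a b S" "broom_set c d R \<noteq> broom_set a b S"
        using 2(3) c(1) by auto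
      then have le: "a \<le> c" "d \<le> b" "R \<subseteq> S"
        using broom_set_subset_iff[OF c(2)] by auto
      have "d = b" "c \<le> b"
        using 2(2) c(1) le(2) by auto
      moreover have "(c, R) \<noteq> (a, S)"
        using sub(2) \<open>d = b\<close> by auto
      ultimately have "(c, R) \<in> ?D"
        using le by simp
      moreover have "\<sigma> = broom_set c b R"
        using c(1) \<open>d = b\<close> by simp
      ultimately show ?thesis
        by (intro that)
    qed
    then show "\<sigma> \<in> (\<lambda>(c, R). broom_set c b R) ` ?D"
      by force
  next
    fix \<sigma> assume "\<sigma> \<in> (\<lambda>(c, R). broom_set c b R) ` ?D"
    then obtain x where "x \<in> ?D" "\<sigma> = (\<lambda>(c, R). broom_set c b R) x"
      by (rule imageE)
    moreover obtain c R where "x = (c, R)"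
      by (rule prod.exhaust)
    ultimately have \<sigma>: "\<sigma> = broom_set c b R" and cR: "(c, R) \<in> ?D"
      by simp_all
    from cR have cR: "a \<le> c" "c \<le> b" "R \<subseteq> S" "(c, R) \<noteq> (a, S)"
      by simp_all
    have "finite R"
      using cR(3) S(1) finite_subset by blast
    show "\<sigma> \<in> insert {Inl b} {\<sigma> \<in> ?B. Inl b \<in> \<sigma> \<and> \<sigma> \<subset> ?V}"
    proof (cases "c < b \<or> R \<noteq> {}")
      case True
      have "\<sigma> \<in> ?B"
        using True cR S(2) ab(2) \<open>finite R\<close> by (auto simp: \<sigma> broom_set_in_broom_tubes_iff)
      moreover have "\<sigma> \<subseteq> ?V" "\<sigma> \<noteq> ?V"
        using cR broom_set_subset_iff[OF cR(2), of R a b S] broom_set_eq_iff[OF cR(2) ab(1), of R S]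
        by (simp_all add: \<sigma>)
      moreover have "Inl b \<in> \<sigma>"
        using cR by (simp add: \<sigma>)
      ultimately show ?thesis by auto
    next
      case False
      then have "\<sigma> = {Inl b}"
        using cR by (simp add: \<sigma> broom_set_def)
      then show ?thesis by simp
    qed
  qed
  have diff: "?V - broom_set c b R = Inl ` {a..<c} \<union> Inr ` (S - R)" if "c \<le> b" for c R
  proof (intro set_eqI)
    fix x show "x \<in> ?V - broom_set c b R \<longleftrightarrow> x \<in> Inl ` {a..<c} \<union> Inr ` (S - R)"
      using that by (cases x) auto
  qed
  have "0 < card S" if "S \<noteq> {}"
    using that S(1) by (simp add: card_gt_0_iff)
  then have "1 < Suc b - a + card S"
    using ab(1) ne by (cases "S = {}") simp_all
  then have V: "finite ?V" "Inl b \<in> ?V" "1 < card ?V"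
    using ab(1) S(1) by (simp_all add: card_broom_set)
  show ?thesis
    unfolding nesting_poly_rec[OF card_broom_tubes V] outermost_eq sum.reindex[OF inj]
    by (intro sum.cong refl) (auto simp: diff)
qed

lemma broom_poly_0_0 [simp]: "broom_poly 0 0 y = 1"
proof -
  have "nestings (broom_tubes 0) (broom_set 0 0 {..<0}) = {{}}"
    by (intro nestings_small(1)[OF card_broom_tubes]) (simp_all add: card_broom_set)
  then show ?thesis
    by (simp add: broom_poly_def nesting_poly_def card_broom_set)
qed

text \<open>Sorting the summands by the shape of the outermost member turns the sum over sets into a
  convolution, provided that the polynomial of a smaller tube depends only on its shape. That proviso
  is an induction hypothesis in the lemma after this one, which proves it in general.\<close>

lemma nesting_poly_broom_set_convolution:
  fixes y :: "'r::comm_ring_1"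
  assumes IH: "\<forall>a b n S. b - a + card S < N \<and> a \<le> b \<and> b \<le> n \<and> finite S \<and> (S = {} \<or> b = n) \<longrightarrow>
      nesting_poly (broom_tubes n) y (broom_set a b S) = broom_poly (b - a) (card S) y"
    and le: "b - a + card S \<le> N"
    and ab: "a \<le> b" "b \<le> n" "finite S" "S = {} \<or> b = n" and ne: "a < b \<or> S \<noteq> {}"
  shows "nesting_poly (broom_tubes n) y (broom_set a b S) =
    (\<Sum>i\<le>b - a. \<Sum>j\<le>card S. of_nat (card S choose j) *
      (broom_poly i j y * gap_weight (\<lambda>g. broom_poly g 0 y) y (b - a - i) (card S - j)))"
proof -
  let ?p = "\<lambda>g. broom_poly g 0 y"
  have step: "nesting_poly (broom_tubes n) y (broom_set c b R) *
      weak_nesting_poly (broom_tubes n) y (Inl ` {a..<c} \<union> Inr ` (S - R)) =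
      broom_poly (b - c) (card R) y * gap_weight ?p y (c - a) (card S - card R)"
    if "(c, R) \<in> {a..b} \<times> Pow S - {(a, S)}" for c R
  proof -
    have c: "a \<le> c" "c \<le> b" "R \<subseteq> S" "a < c \<or> R \<noteq> S"
      using that by auto
    then have R: "finite R" "card R \<le> card S" "R \<noteq> S \<Longrightarrow> card R < card S"
      using ab(3) by (auto intro: finite_subset card_mono psubset_card_mono)
    have "b - c + card R < N"
    proof (cases "a < c")
      case True
      then show ?thesis
        using c R le by linarith
    next
      case False
      then show ?thesis
        using c R le by fastforce
    qed
    moreover have "R = {} \<or> b = n"
      using ab(4) c(3) by auto
    ultimately have 1: "nesting_poly (broom_tubes n) y (broom_set c b R) = broom_poly (b - c) (card R) y"
      using IH c ab R by blast
    have 2: "weak_nesting_poly (broom_tubes n) y (Inl ` {a..<c} \<union> Inr ` (S - R)) =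
        gap_weight ?p y (c - a) (card (S - R))"
    proof (rule weak_nesting_poly_gap)
      fix g assume g: "1 < g" "a + g = c"
      then have "c - 1 - a + card ({} :: nat set) < N" "a \<le> c - 1" "c - 1 \<le> n"
        using c le ab by auto
      then have "nesting_poly (broom_tubes n) y (broom_set a (c - 1) {}) =
          broom_poly (c - 1 - a) (card ({} :: nat set)) y"
        by (intro IH[rule_format]) simp
      moreover have "c - 1 - a = g - 1"
        using g by simp
      ultimately show "nesting_poly (broom_tubes n) y (broom_set a (c - 1) {}) = ?p (g - 1)"
        by simp
    qed (use c ab in auto)
    show ?thesis
      unfolding 1 2 using c(3) R(1) by (simp add: card_Diff_subset)
  qed
  have zero: "gap_weight ?p y 0 0 = 0"
    by (simp add: gap_weight_def)
  have "nesting_poly (broom_tubes n) y (broom_set a b S) =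
      (\<Sum>(c, R)\<in>{a..b} \<times> Pow S - {(a, S)}.
        broom_poly (b - c) (card R) y * gap_weight ?p y (c - a) (card S - card R))"
    unfolding nesting_poly_broom_set_rec[OF ab ne]
    by (rule sum.cong[OF refl]) (simp only: split_paired_all prod.case step)
  also have "\<dots> = (\<Sum>(c, R)\<in>{a..b} \<times> Pow S.
        broom_poly (b - c) (card R) y * gap_weight ?p y (c - a) (card S - card R))"
  proof (rule sum.mono_neutral_left)
    show "\<forall>x\<in>{a..b} \<times> Pow S - ({a..b} \<times> Pow S - {(a, S)}).
        (case x of (c, R) \<Rightarrow> broom_poly (b - c) (card R) y * gap_weight ?p y (c - a) (card S - card R)) = 0"
    proof
      fix x assume "x \<in> {a..b} \<times> Pow S - ({a..b} \<times> Pow S - {(a, S)})"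
      then have "x = (a, S)" by blast
      then show "(case x of (c, R) \<Rightarrow> broom_poly (b - c) (card R) y * gap_weight ?p y (c - a) (card S - card R)) = 0"
        by (simp add: zero)
    qed
  qed (use ab(3) in blast)+
  also have "\<dots> = (\<Sum>c\<in>{a..b}. \<Sum>R\<in>Pow S.
        broom_poly (b - c) (card R) y * gap_weight ?p y (c - a) (card S - card R))"
    by (rule sum.cartesian_product[symmetric])
  also have "\<dots> = (\<Sum>c\<in>{a..b}. \<Sum>j\<le>card S. of_nat (card S choose j) *
        (broom_poly (b - c) j y * gap_weight ?p y (c - a) (card S - j)))"
    by (intro sum.cong refl sum_Pow_card ab(3))
  also have "\<dots> = (\<Sum>i\<le>b - a. \<Sum>j\<le>card S. of_nat (card S choose j) *
      (broom_poly i j y * gap_weight ?p y (b - a - i) (card S - j)))"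
    by (rule sum.reindex_bij_witness[of _ "\<lambda>i. b - i" "\<lambda>c. b - c"]) (use ab in auto)
  finally show ?thesis .
qed

text \<open>Two tubes of the same shape satisfy the same convolution formula, even in different brooms, so no
  isomorphism between them has to be constructed.\<close>

lemma nesting_poly_broom_set_eq:
  fixes y :: "'r::comm_ring_1"
  assumes "a \<le> b" "b \<le> n" "finite S" "S = {} \<or> b = n"
  shows "nesting_poly (broom_tubes n) y (broom_set a b S) = broom_poly (b - a) (card S) y"
  using assms
proof (induction "b - a + card S" arbitrary: a b n S rule: less_induct)
  case less
  have "\<forall>a' b' n' S'. b' - a' + card S' < b - a + card S \<and> a' \<le> b' \<and> b' \<le> n' \<and> finite S' \<and> (S' = {} \<or> b' = n') \<longrightarrow>
      nesting_poly (broom_tubes n') y (broom_set a' b' S') = broom_poly (b' - a') (card S') y"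
    using less.hyps by blast
  note conv = nesting_poly_broom_set_convolution[OF this]
  show ?case
  proof (cases "a < b \<or> S \<noteq> {}")
    case True
    then have "0 < b - a \<or> {..<card S} \<noteq> {}"
      using less.prems(3) by (auto simp: lessThan_empty_iff)
    then have "nesting_poly (broom_tubes (b - a)) y (broom_set 0 (b - a) {..<card S}) =
        nesting_poly (broom_tubes n) y (broom_set a b S)"
      using conv[OF order_refl less.prems True] conv[of "b - a" 0 "{..<card S}" "b - a"] by simp
    then show ?thesis
      by (simp add: broom_poly_def)
  next
    case False
    then have "a = b" "S = {}"
      using less.prems by auto
    moreover have "nestings (broom_tubes n) (broom_set b b {}) = {{}}"
      by (intro nestings_small(1)[OF card_broom_tubes]) (simp_all add: card_broom_set)
    ultimately show ?thesis
      by (simp add: nesting_poly_def card_broom_set)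
  qed
qed

text \<open>In generating functions this says \<open>W = 1 + W G\<close>.\<close>

lemma broom_poly_rec:
  assumes "n + k \<ge> 1"
  shows "broom_poly n k y =
    (\<Sum>i\<le>n. \<Sum>j\<le>k. of_nat (k choose j) *
      (broom_poly i j y * gap_weight (\<lambda>g. broom_poly g 0 y) y (n - i) (k - j)))"
proof -
  have "0 < n \<or> {..<k} \<noteq> {}"
    using assms by (auto simp: lessThan_empty_iff)
  moreover have "\<forall>a' b' n' S'. b' - a' + card S' < n - 0 + card {..<k} \<and> a' \<le> b' \<and> b' \<le> n' \<and> finite S' \<and> (S' = {} \<or> b' = n') \<longrightarrow>
      nesting_poly (broom_tubes n') y (broom_set a' b' S') = broom_poly (b' - a') (card S') y"
    using nesting_poly_broom_set_eq by blast
  ultimately have "nesting_poly (broom_tubes n) y (broom_set 0 n {..<k}) =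
    (\<Sum>i\<le>n - 0. \<Sum>j\<le>card {..<k}. of_nat (card {..<k} choose j) *
      (broom_poly i j y * gap_weight (\<lambda>g. broom_poly g 0 y) y (n - 0 - i) (card {..<k} - j)))"
    by (intro nesting_poly_broom_set_convolution) auto
  then show ?thesis
    unfolding broom_poly_def [of n k] by simp
qed

section \<open>Generating functions\<close>

text \<open>Exponential generating functions in one variable, and generating functions that are ordinary in the
  first index (chain elements, unlabelled) and exponential in the second (leaves, labelled).\<close>

definition egf :: "(nat \<Rightarrow> real) \<Rightarrow> real fps" where
  "egf a = Abs_fps (\<lambda>k. a k / fact k)"

definition bgf :: "(nat \<Rightarrow> nat \<Rightarrow> real) \<Rightarrow> real fps fps" where
  "bgf a = Abs_fps (\<lambda>n. egf (a n))"

lemma egf_eq_iff: "egf a = egf b \<longleftrightarrow> (\<forall>k. a k = b k)"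
  by (simp add: egf_def fps_eq_iff)

lemma egf_add: "egf a + egf b = egf (\<lambda>k. a k + b k)"
  by (simp add: egf_def fps_eq_iff add_divide_distrib)

lemma egf_const: "fps_const c = egf (\<lambda>k. if k = 0 then c else 0)"
  by (simp add: egf_def fps_eq_iff)

lemma egf_const_mult: "fps_const c * egf a = egf (\<lambda>k. c * a k)"
  by (simp add: egf_def fps_eq_iff)

lemma egf_mult: "egf a * egf b = egf (\<lambda>k. \<Sum>j\<le>k. real (k choose j) * (a j * b (k - j)))"
proof (rule fps_ext)
  fix k
  have "fps_nth (egf a * egf b) k = (\<Sum>j\<le>k. a j / fact j * (b (k - j) / fact (k - j)))"
    by (simp add: egf_def fps_mult_nth atLeast0AtMost)
  also have "\<dots> = (\<Sum>j\<le>k. real (k choose j) * (a j * b (k - j)) / fact k)"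
    by (intro sum.cong refl) (simp add: binomial_fact)
  finally show "fps_nth (egf a * egf b) k = fps_nth (egf (\<lambda>k. \<Sum>j\<le>k. real (k choose j) * (a j * b (k - j)))) k"
    by (simp add: egf_def sum_divide_distrib)
qed

lemma egf_sum: "finite I \<Longrightarrow> (\<Sum>i\<in>I. egf (a i)) = egf (\<lambda>k. \<Sum>i\<in>I. a i k)"
proof (induction I rule: finite_induct)
  case empty
  show ?case by (simp add: egf_def fps_eq_iff)
qed (simp add: egf_add)

lemma bgf_eq_iff: "bgf a = bgf b \<longleftrightarrow> (\<forall>n k. a n k = b n k)"
  by (simp add: bgf_def fps_eq_iff [where 'a = "real fps"] egf_eq_iff)

lemma bgf_add: "bgf a + bgf b = bgf (\<lambda>n k. a n k + b n k)"
  by (simp add: bgf_def fps_eq_iff [where 'a = "real fps"] egf_add)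

lemma bgf_mult: "bgf a * bgf b =
    bgf (\<lambda>n k. \<Sum>i\<le>n. \<Sum>j\<le>k. real (k choose j) * (a i j * b (n - i) (k - j)))"
  by (rule fps_ext) (simp add: bgf_def fps_mult_nth atLeast0AtMost egf_mult egf_sum)

lemma bgf_1: "1 = bgf (\<lambda>n k. if n = 0 \<and> k = 0 then 1 else 0)"
  by (rule fps_ext, rule fps_ext) (simp add: bgf_def egf_def)

lemma bgf_const_mult: "fps_const (fps_const c) * bgf a = bgf (\<lambda>n k. c * a n k)"
  by (simp add: bgf_def fps_eq_iff [where 'a = "real fps"] egf_const_mult)

text \<open>For factors of this shape and of the two shapes below the double convolution collapses.\<close>

lemma bgf_mult_separated:
  "bgf (\<lambda>n k. if k = 0 then a n else 0) * bgf (\<lambda>n k. if n = 0 then c k else 0) = bgf (\<lambda>n k. a n * c k)"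
proof -
  have "(\<Sum>i\<le>n. \<Sum>j\<le>k. real (k choose j) * ((if j = 0 then a i else 0) * (if n - i = 0 then c (k - j) else 0)))
      = (\<Sum>i\<le>n. if i = n then a n * c k else 0)" for n k
  proof (intro sum.cong refl)
    fix i assume i: "i \<in> {..n}"
    have "(\<Sum>j\<le>k. real (k choose j) * ((if j = 0 then a i else 0) * (if n - i = 0 then c (k - j) else 0)))
        = (\<Sum>j\<le>k. if j = 0 then a i * (if n - i = 0 then c k else 0) else 0)"
      by (intro sum.cong) auto
    then show "(\<Sum>j\<le>k. real (k choose j) * ((if j = 0 then a i else 0) * (if n - i = 0 then c (k - j) else 0)))
        = (if i = n then a n * c k else 0)"
      using i by simp
  qed
  then show ?thesis
    unfolding bgf_mult bgf_eq_iff by simp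
qed

lemma bgf_mult_ordinary:
  "bgf (\<lambda>n k. if k = 0 then a n else 0) * bgf (\<lambda>n k. if k = 0 then c n else 0) =
    bgf (\<lambda>n k. if k = 0 then \<Sum>i\<le>n. a i * c (n - i) else 0)"
  unfolding bgf_mult bgf_eq_iff
proof (intro allI)
  fix n k :: nat
  show "(\<Sum>i\<le>n. \<Sum>j\<le>k. real (k choose j) * ((if j = 0 then a i else 0) * (if k - j = 0 then c (n - i) else 0))) =
      (if k = 0 then \<Sum>i\<le>n. a i * c (n - i) else 0)"
    by (cases "k = 0") (simp, auto intro!: sum.neutral)
qed

lemma bgf_mult_exponential:
  "bgf (\<lambda>n k. if n = 0 then a k else 0) * bgf (\<lambda>n k. if n = 0 then c k else 0) =
    bgf (\<lambda>n k. if n = 0 then \<Sum>j\<le>k. real (k choose j) * (a j * c (k - j)) else 0)"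
  unfolding bgf_mult bgf_eq_iff
proof (intro allI)
  fix n k :: nat
  show "(\<Sum>i\<le>n. \<Sum>j\<le>k. real (k choose j) * ((if i = 0 then a j else 0) * (if n - i = 0 then c (k - j) else 0))) =
      (if n = 0 then \<Sum>j\<le>k. real (k choose j) * (a j * c (k - j)) else 0)"
    by (cases "n = 0") (simp, auto intro!: sum.neutral)
qed

section \<open>Quadratic and bilinear recursions\<close>

lemma broom_poly_path_rec:
  "broom_poly (Suc n) 0 y = (\<Sum>i\<le>n. broom_poly i 0 y * gap_weight (\<lambda>g. broom_poly g 0 y) y (Suc (n - i)) 0)"
proof -
  have "broom_poly (Suc n) 0 y =
      (\<Sum>i\<le>Suc n. broom_poly i 0 y * gap_weight (\<lambda>g. broom_poly g 0 y) y (Suc n - i) 0)"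
    by (subst broom_poly_rec) simp_all
  also have "\<dots> = (\<Sum>i\<le>n. broom_poly i 0 y * gap_weight (\<lambda>g. broom_poly g 0 y) y (Suc n - i) 0)"
    by (simp add: gap_weight_def)
  finally show ?thesis
    by (simp add: Suc_diff_le)
qed

lemma broom_poly_1_0: "broom_poly 1 0 y = 1"
  using broom_poly_path_rec[of 0 y] by (simp add: gap_weight_def)

text \<open>The two summands \<open>i = 0\<close> and \<open>i = n\<close> of the recursion are both multiples of the polynomial of the chain
  \<open>n\<close>; together they make the coefficient \<open>(1 + y) + 1\<close>.\<close>

lemma broom_poly_path_quadratic:
  assumes "n \<ge> 1"
  shows "broom_poly (Suc n) 0 y = (2 + y) * broom_poly n 0 y +
    (1 + y) * (\<Sum>i\<in>{1..<n}. broom_poly i 0 y * broom_poly (n - i) 0 y)"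
proof -
  let ?b = "\<lambda>n. broom_poly n 0 y"
  have gap: "gap_weight ?b y (Suc (n - i)) 0 = (if i = n then 1 else (1 + y) * ?b (n - i))" if "i \<le> n" for i
    using that by (simp add: gap_weight_def)
  have "?b (Suc n) = (\<Sum>i\<in>insert 0 (insert n {1..<n}). ?b i * gap_weight ?b y (Suc (n - i)) 0)"
    unfolding broom_poly_path_rec using assms by (intro sum.cong) auto
  also have "\<dots> = (1 + y) * ?b n + (?b n + (\<Sum>i\<in>{1..<n}. ?b i * gap_weight ?b y (Suc (n - i)) 0))"
    using assms gap[of 0] gap[of n] by simp
  also have "(\<Sum>i\<in>{1..<n}. ?b i * gap_weight ?b y (Suc (n - i)) 0) =
      (1 + y) * (\<Sum>i\<in>{1..<n}. ?b i * ?b (n - i))"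
    unfolding sum_distrib_left by (intro sum.cong refl) (simp add: gap ac_simps)
  finally show ?thesis
    by (simp add: algebra_simps)
qed

lemma broom_poly_star_rec:
  assumes "k \<ge> 1"
  shows "broom_poly 0 k y = (\<Sum>j\<le>k. of_nat (k choose j) *
    (broom_poly 0 j y * gap_weight (\<lambda>g. broom_poly g 0 y) y 0 (k - j)))"
  using assms by (subst broom_poly_rec) simp_all

lemma broom_poly_0_1: "broom_poly 0 1 y = 1"
proof -
  have "broom_poly 0 1 y = (\<Sum>j\<in>{0, 1}. of_nat (1 choose j) *
      (broom_poly 0 j y * gap_weight (\<lambda>g. broom_poly g 0 y) y 0 (1 - j)))"
    by (subst broom_poly_star_rec) (auto simp: atMost_Suc)
  then show ?thesis
    by (simp add: gap_weight_def)
qed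

text \<open>With \<open>Q = 1 + q\<close> the recursion for stars is \<open>(1 - E) Q = 1\<close>. Differentiating \<open>q = E Q\<close> and using
  \<open>E' = 1 + y E\<close> gives \<open>q' = (1 + y E) Q\<^sup>2 = (Q + y q) Q\<close>, which is quadratic in \<open>q\<close> alone.\<close>

lemma broom_poly_star_quadratic:
  fixes y :: real
  assumes "k \<ge> 1"
  shows "broom_poly 0 (Suc k) y = (2 + y) * broom_poly 0 k y +
    (1 + y) * (\<Sum>j\<in>{1..<k}. real (k choose j) * (broom_poly 0 j y * broom_poly 0 (k - j) y))"
proof -
  let ?b = "\<lambda>k. broom_poly 0 k y"
  let ?q = "\<lambda>k. if k = 0 then 0 else ?b k"
  define E where "E = egf (\<lambda>m. gap_weight (\<lambda>g. broom_poly g 0 y) y 0 m)"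
  define q where "q = egf ?q"
  define Y where "Y = fps_const y"
  have Q: "1 + q = egf ?b"
    unfolding fps_const_1_eq_1 [symmetric] egf_const q_def egf_add by (simp add: egf_eq_iff)
  have q: "q = E * (1 + q)"
  proof -
    have "?q k = (\<Sum>j\<le>k. real (k choose j) * (?b j * gap_weight (\<lambda>g. broom_poly g 0 y) y 0 (k - j)))" for k
      using broom_poly_star_rec[of k y] by (cases "k = 0") (simp_all add: gap_weight_def)
    then have "q = egf ?b * E"
      unfolding q_def E_def egf_mult egf_eq_iff by blast
    then show ?thesis
      unfolding Q by (simp add: mult.commute)
  qed
  have E': "fps_deriv E = 1 + Y * E"
  proof (rule fps_ext)
    fix m
    have "fact (Suc m) = real (Suc m) * fact m"
      by simp
    then show "fps_nth (fps_deriv E) m = fps_nth (1 + Y * E) m"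
      by (cases m) (simp_all add: E_def Y_def egf_def gap_weight_def field_simps del: of_nat_Suc)
  qed
  have unit: "(1 - E) * (1 + q) = 1"
    using q by (simp add: algebra_simps)
  have "fps_deriv q = fps_deriv (E * (1 + q))"
    using q by simp
  then have "(1 - E) * fps_deriv q = (1 + Y * E) * (1 + q)"
    by (simp add: E' algebra_simps)
  then have "(1 + q) * ((1 - E) * fps_deriv q) = (1 + q) * ((1 + Y * E) * (1 + q))"
    by simp
  moreover have "(1 + q) * ((1 - E) * fps_deriv q) = ((1 - E) * (1 + q)) * fps_deriv q"
    by (simp only: ac_simps)
  moreover have "(1 + q) * ((1 + Y * E) * (1 + q)) = (1 + q + Y * (E * (1 + q))) * (1 + q)"
    by (simp add: algebra_simps)
  ultimately have "((1 - E) * (1 + q)) * fps_deriv q = (1 + q + Y * (E * (1 + q))) * (1 + q)"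
    by simp
  then have "fps_deriv q = (1 + q + Y * q) * (1 + q)"
    unfolding unit q [symmetric] by simp
  also have "\<dots> = 1 + (fps_const (2 + y) * q + fps_const (1 + y) * (q * q))"
    by (simp add: Y_def algebra_simps flip: fps_const_add)
  also have "q * q = egf (\<lambda>k. \<Sum>j\<le>k. real (k choose j) * (?q j * ?q (k - j)))"
    by (simp add: q_def egf_mult)
  finally have deriv_q: "fps_deriv q = 1 + (fps_const (2 + y) * q + fps_const (1 + y) *
      egf (\<lambda>k. \<Sum>j\<le>k. real (k choose j) * (?q j * ?q (k - j))))" .
  have "?b (Suc k) / fact k = fps_nth (fps_deriv q) k"
    by (simp add: q_def egf_def del: of_nat_Suc)
  also have "\<dots> = ((2 + y) * ?b k + (1 + y) * (\<Sum>j\<le>k. real (k choose j) * (?q j * ?q (k - j)))) / fact k"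
    unfolding deriv_q using assms by (simp add: q_def egf_def add_divide_distrib)
  also have "(\<Sum>j\<le>k. real (k choose j) * (?q j * ?q (k - j))) =
      (\<Sum>j\<in>{1..<k}. real (k choose j) * (?b j * ?b (k - j)))"
    by (rule sum.mono_neutral_cong_right) auto
  finally show ?thesis
    by simp
qed

text \<open>The identity \<open>P Q (1 - G) = 1 - (1 + y) p q\<close> expresses the broom series \<open>W = 1 / (1 - G)\<close> through
  the series \<open>P = 1 + p\<close> of chains and \<open>Q = 1 + q\<close> of stars. The summand \<open>(i, j) = (n, k)\<close> is separated
  because there the remaining broom is a point; added to the product of the constant parts it makes
  the coefficient \<open>2 + y\<close>.\<close>

lemma broom_poly_bilinear:
  fixes y :: real
  assumes "n \<ge> 1" "k \<ge> 1"
  shows "broom_poly n k y = (2 + y) * (broom_poly n 0 y * broom_poly 0 k y) +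
    (1 + y) * (\<Sum>(i, j)\<in>{1..n} \<times> {1..k} - {(n, k)}. real (k choose j) *
      (broom_poly i 0 y * broom_poly 0 j y * broom_poly (n - i) (k - j) y))"
proof -
  let ?b = "\<lambda>n k. broom_poly n k y"
  let ?gap = "gap_weight (\<lambda>g. ?b g 0) y"
  define W where "W = bgf ?b"
  define G where "G = bgf ?gap"
  define P where "P = bgf (\<lambda>n k. if k = 0 then ?b n 0 else 0)"
  define Q where "Q = bgf (\<lambda>n k. if n = 0 then ?b 0 k else 0)"
  define s where "s = bgf (\<lambda>n k. if k = 0 then ?gap n 0 else 0)"
  define E where "E = bgf (\<lambda>n k. if n = 0 then ?gap 0 k else 0)"
  define Y :: "real fps fps" where "Y = fps_const (fps_const y)"
  have zero: "?gap 0 0 = 0"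
    by (simp add: gap_weight_def)
  have W: "W = 1 + W * G"
    unfolding W_def G_def bgf_mult bgf_1 bgf_add bgf_eq_iff
    using broom_poly_rec[of _ _ y] zero by (auto simp: le_Suc_eq)
  have P: "P = 1 + P * s"
    unfolding P_def s_def bgf_mult_ordinary bgf_1 bgf_add bgf_eq_iff
    using broom_poly_rec[of _ 0 y] zero by (auto simp: le_Suc_eq)
  have Q: "Q = 1 + Q * E"
    unfolding Q_def E_def bgf_mult_exponential bgf_1 bgf_add bgf_eq_iff
    using broom_poly_rec[of 0 _ y] zero by (auto simp: le_Suc_eq)
  have G: "G = s + E + Y * (s * E)"
    unfolding G_def s_def E_def bgf_mult_separated Y_def bgf_const_mult bgf_add bgf_eq_iff
    by (auto simp: gap_weight_def power_eq_if)
  define p where "p = bgf (\<lambda>n k. if k = 0 then if n = 0 then 0 else ?b n 0 else 0)"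
  define q where "q = bgf (\<lambda>n k. if n = 0 then if k = 0 then 0 else ?b 0 k else 0)"
  have Pp: "P = 1 + p" and Qq: "Q = 1 + q"
    unfolding P_def Q_def p_def q_def bgf_1 bgf_add bgf_eq_iff by simp_all
  have ps: "P * s = p" and qE: "Q * E = q"
    using P Q Pp Qq by simp_all
  have "P * Q * (1 - G) = P * Q - (P * s) * Q - P * (Q * E) - Y * ((P * s) * (Q * E))"
    by (simp add: G algebra_simps)
  also have "\<dots> = 1 - (1 + Y) * (p * q)"
    unfolding ps qE by (simp add: Pp Qq algebra_simps)
  finally have "(P * Q * (1 - G)) * W = (1 - (1 + Y) * (p * q)) * W"
    by simp
  moreover have "(1 - G) * W = 1"
    using W by (simp add: algebra_simps)
  ultimately have "P * Q = (1 - (1 + Y) * (p * q)) * W"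
    by (metis mult.assoc mult_1_right)
  then have Wrec: "W = P * Q + fps_const (fps_const (1 + y)) * (p * q * W)"
    by (simp add: Y_def algebra_simps flip: fps_const_add)
  have PQ: "P * Q = bgf (\<lambda>n k. ?b n 0 * ?b 0 k)"
    unfolding P_def Q_def by (rule bgf_mult_separated)
  have pqW: "p * q * W = bgf (\<lambda>n k. \<Sum>i\<le>n. \<Sum>j\<le>k. real (k choose j) *
      ((if i = 0 then 0 else ?b i 0) * (if j = 0 then 0 else ?b 0 j) * ?b (n - i) (k - j)))"
    unfolding p_def q_def bgf_mult_separated W_def bgf_mult ..
  have "W = bgf (\<lambda>n k. ?b n 0 * ?b 0 k) + fps_const (fps_const (1 + y)) *
      bgf (\<lambda>n k. \<Sum>i\<le>n. \<Sum>j\<le>k. real (k choose j) *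
        ((if i = 0 then 0 else ?b i 0) * (if j = 0 then 0 else ?b 0 j) * ?b (n - i) (k - j)))"
    unfolding PQ [symmetric] pqW [symmetric] by (rule Wrec)
  then have "?b n k = ?b n 0 * ?b 0 k + (1 + y) * (\<Sum>i\<le>n. \<Sum>j\<le>k. real (k choose j) *
      ((if i = 0 then 0 else ?b i 0) * (if j = 0 then 0 else ?b 0 j) * ?b (n - i) (k - j)))"
    unfolding W_def bgf_const_mult bgf_add bgf_eq_iff by blast
  also have "(\<Sum>i\<le>n. \<Sum>j\<le>k. real (k choose j) *
      ((if i = 0 then 0 else ?b i 0) * (if j = 0 then 0 else ?b 0 j) * ?b (n - i) (k - j))) =
      (\<Sum>(i, j)\<in>{..n} \<times> {..k}. real (k choose j) *
      ((if i = 0 then 0 else ?b i 0) * (if j = 0 then 0 else ?b 0 j) * ?b (n - i) (k - j)))"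
    by (rule sum.cartesian_product)
  also have "\<dots> = (\<Sum>(i, j)\<in>{1..n} \<times> {1..k}. real (k choose j) * (?b i 0 * ?b 0 j * ?b (n - i) (k - j)))"
    by (rule sum.mono_neutral_cong_right) (auto split: if_splits)
  also have "\<dots> = ?b n 0 * ?b 0 k +
      (\<Sum>(i, j)\<in>{1..n} \<times> {1..k} - {(n, k)}. real (k choose j) * (?b i 0 * ?b 0 j * ?b (n - i) (k - j)))"
    using assms by (subst sum.remove[of _ "(n, k)"]) auto
  finally show ?thesis
    by (simp add: algebra_simps)
qed

section \<open>Nonnegativity of the gamma vector\<close>

definition broom_h_poly :: "nat \<Rightarrow> nat \<Rightarrow> int poly" where
  "broom_h_poly n k = h_poly (tubing_f_poly (broom n k))"

text \<open>The shift by \<open>1\<close> is the passage from the \<open>f\<close>- to the \<open>h\<close>-polynomial. It turns the coefficients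
  \<open>2 + y\<close> and \<open>1 + y\<close> above into \<open>1 + t\<close> and \<open>t\<close>.\<close>

lemma poly_broom_h_poly:
  assumes "n + k \<ge> 1"
  shows "real_of_int (poly (broom_h_poly n k) x) = broom_poly n k (real_of_int x - 1)"
  using of_int_poly_tubing_f_poly_broom[OF assms, of "x - 1", where 'a = real]
  by (simp add: broom_h_poly_def h_poly_def poly_pcompose)

text \<open>Integer polynomials are compared through their real values at integers, since the generating functions
  need division by factorials.\<close>

lemma int_poly_eqI:
  fixes p q :: "int poly"
  assumes "\<And>x. real_of_int (poly p x) = real_of_int (poly q x)"
  shows "p = q"
  using assms by (intro poly_eq_poly_eq_iff[THEN iffD1] ext) simp

lemma broom_h_poly_1: "broom_h_poly 1 0 = 1" "broom_h_poly 0 1 = 1"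
  by (rule int_poly_eqI; simp add: poly_broom_h_poly broom_poly_1_0 [simplified] broom_poly_0_1 [simplified])+

lemma broom_h_poly_path:
  assumes "n \<ge> 1"
  shows "broom_h_poly (Suc n) 0 = [:1, 1:] * broom_h_poly n 0 +
    [:0, 1:] * (\<Sum>i\<in>{1..<n}. broom_h_poly i 0 * broom_h_poly (n - i) 0)"
proof (rule int_poly_eqI)
  fix x
  have "(\<Sum>i\<in>{1..<n}. broom_poly i 0 (real_of_int x - 1) * broom_poly (n - i) 0 (real_of_int x - 1)) =
      real_of_int (poly (\<Sum>i\<in>{1..<n}. broom_h_poly i 0 * broom_h_poly (n - i) 0) x)"
    unfolding poly_sum of_int_sum
    by (intro sum.cong refl) (auto simp: poly_broom_h_poly)
  then show "real_of_int (poly (broom_h_poly (Suc n) 0) x) =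
      real_of_int (poly ([:1, 1:] * broom_h_poly n 0 +
        [:0, 1:] * (\<Sum>i\<in>{1..<n}. broom_h_poly i 0 * broom_h_poly (n - i) 0)) x)"
    using assms by (simp add: poly_broom_h_poly broom_poly_path_quadratic ring_distribs)
qed

lemma broom_h_poly_star:
  assumes "k \<ge> 1"
  shows "broom_h_poly 0 (Suc k) = [:1, 1:] * broom_h_poly 0 k +
    [:0, 1:] * (\<Sum>j\<in>{1..<k}. of_nat (k choose j) * (broom_h_poly 0 j * broom_h_poly 0 (k - j)))"
proof (rule int_poly_eqI)
  fix x
  have "(\<Sum>j\<in>{1..<k}. real (k choose j) *
        (broom_poly 0 j (real_of_int x - 1) * broom_poly 0 (k - j) (real_of_int x - 1))) =
      real_of_int (poly (\<Sum>j\<in>{1..<k}. of_nat (k choose j) * (broom_h_poly 0 j * broom_h_poly 0 (k - j))) x)"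
    unfolding poly_sum of_int_sum
    by (intro sum.cong refl) (auto simp: poly_broom_h_poly)
  then show "real_of_int (poly (broom_h_poly 0 (Suc k)) x) =
      real_of_int (poly ([:1, 1:] * broom_h_poly 0 k +
        [:0, 1:] * (\<Sum>j\<in>{1..<k}. of_nat (k choose j) * (broom_h_poly 0 j * broom_h_poly 0 (k - j)))) x)"
    using assms by (simp add: poly_broom_h_poly broom_poly_star_quadratic ring_distribs)
qed

lemma broom_h_poly_broom:
  assumes "n \<ge> 1" "k \<ge> 1"
  shows "broom_h_poly n k = [:1, 1:] * (broom_h_poly n 0 * broom_h_poly 0 k) +
    [:0, 1:] * (\<Sum>(i, j)\<in>{1..n} \<times> {1..k} - {(n, k)}.
      of_nat (k choose j) * (broom_h_poly i 0 * broom_h_poly 0 j * broom_h_poly (n - i) (k - j)))"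
proof (rule int_poly_eqI)
  fix x
  have "(\<Sum>(i, j)\<in>{1..n} \<times> {1..k} - {(n, k)}. real (k choose j) *
      (broom_poly i 0 (real_of_int x - 1) * broom_poly 0 j (real_of_int x - 1) *
        broom_poly (n - i) (k - j) (real_of_int x - 1))) =
    real_of_int (poly (\<Sum>(i, j)\<in>{1..n} \<times> {1..k} - {(n, k)}.
      of_nat (k choose j) * (broom_h_poly i 0 * broom_h_poly 0 j * broom_h_poly (n - i) (k - j))) x)"
    unfolding poly_sum of_int_sum
  proof (intro sum.cong refl)
    fix z assume "z \<in> {1..n} \<times> {1..k} - {(n, k)}"
    moreover obtain i j where "z = (i, j)"
      by (rule prod.exhaust)
    ultimately have "1 \<le> i + 0" "1 \<le> 0 + j" "1 \<le> (n - i) + (k - j)" "z = (i, j)"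
      by auto
    then show "(case z of (i, j) \<Rightarrow> real (k choose j) *
        (broom_poly i 0 (real_of_int x - 1) * broom_poly 0 j (real_of_int x - 1) *
          broom_poly (n - i) (k - j) (real_of_int x - 1))) =
      real_of_int (poly (case z of (i, j) \<Rightarrow>
        of_nat (k choose j) * (broom_h_poly i 0 * broom_h_poly 0 j * broom_h_poly (n - i) (k - j))) x)"
      by (simp only: prod.case poly_mult of_int_mult poly_broom_h_poly poly_of_nat of_int_of_nat_eq)
  qed
  then show "real_of_int (poly (broom_h_poly n k) x) =
      real_of_int (poly ([:1, 1:] * (broom_h_poly n 0 * broom_h_poly 0 k) +
    [:0, 1:] * (\<Sum>(i, j)\<in>{1..n} \<times> {1..k} - {(n, k)}.
      of_nat (k choose j) * (broom_h_poly i 0 * broom_h_poly 0 j * broom_h_poly (n - i) (k - j)))) x)"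
    using assms by (simp add: poly_broom_h_poly broom_poly_bilinear ring_distribs)
qed

lemma gamma_nonneg_path: "n \<ge> 1 \<Longrightarrow> gamma_nonneg (n - 1) (broom_h_poly n 0)"
proof (induction n rule: less_induct)
  case (less n)
  show ?case
  proof (cases "n = 1")
    case True
    then show ?thesis
      using gamma_nonneg_1 broom_h_poly_1(1) by simp
  next
    case False
    then obtain m where m: "n = Suc m" "m \<ge> 1"
      using less.prems by (cases n) auto
    have "gamma_nonneg m ([:1, 1:] * broom_h_poly m 0)"
      using gamma_nonneg_one_plus_mult[OF less.IH[of m]] m by simp
    moreover have "gamma_nonneg m ([:0, 1:] * (broom_h_poly i 0 * broom_h_poly (m - i) 0))"
      if i: "i \<in> {1..<m}" for i
    proof -
      have "gamma_nonneg ((i - 1) + (m - i - 1)) (broom_h_poly i 0 * broom_h_poly (m - i) 0)"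
        using i m by (intro gamma_nonneg_mult less.IH) auto
      moreover have "Suc (Suc ((i - 1) + (m - i - 1))) = m"
        using i by auto
      ultimately show ?thesis
        using gamma_nonneg_var_mult by metis
    qed
    ultimately show ?thesis
      unfolding m(1) broom_h_poly_path[OF m(2)] sum_distrib_left diff_Suc_1
      by (intro gamma_nonneg_add gamma_nonneg_sum)
  qed
qed

lemma gamma_nonneg_star: "k \<ge> 1 \<Longrightarrow> gamma_nonneg (k - 1) (broom_h_poly 0 k)"
proof (induction k rule: less_induct)
  case (less k)
  show ?case
  proof (cases "k = 1")
    case True
    then show ?thesis
      using gamma_nonneg_1 broom_h_poly_1(2) by simp
  next
    case False
    then obtain m where m: "k = Suc m" "m \<ge> 1"
      using less.prems by (cases k) auto
    have "gamma_nonneg m ([:1, 1:] * broom_h_poly 0 m)"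
      using gamma_nonneg_one_plus_mult[OF less.IH[of m]] m by simp
    moreover have "gamma_nonneg m
        ([:0, 1:] * (of_nat (m choose j) * (broom_h_poly 0 j * broom_h_poly 0 (m - j))))"
      if j: "j \<in> {1..<m}" for j
    proof -
      have "gamma_nonneg ((j - 1) + (m - j - 1))
          (of_nat (m choose j) * (broom_h_poly 0 j * broom_h_poly 0 (m - j)))"
        using j m by (intro gamma_nonneg_of_nat_mult gamma_nonneg_mult less.IH) auto
      moreover have "Suc (Suc ((j - 1) + (m - j - 1))) = m"
        using j by auto
      ultimately show ?thesis
        using gamma_nonneg_var_mult by metis
    qed
    ultimately show ?thesis
      unfolding m(1) broom_h_poly_star[OF m(2)] sum_distrib_left diff_Suc_1
      by (intro gamma_nonneg_add gamma_nonneg_sum)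
  qed
qed

text \<open>Degrees: \<open>(1 + t) p\<^sub>n q\<^sub>k\<close> has \<open>1 + (n - 1) + (k - 1)\<close>, and the summand \<open>(i, j)\<close> has
  \<open>2 + (i - 1) + (j - 1) + (n - i + k - j - 1)\<close>; both are \<open>n + k - 1\<close>.\<close>

lemma gamma_nonneg_broom: "n + k \<ge> 1 \<Longrightarrow> gamma_nonneg (n + k - 1) (broom_h_poly n k)"
proof (induction "n + k" arbitrary: n k rule: less_induct)
  case less
  consider "k = 0" | "n = 0" | "n \<ge> 1" "k \<ge> 1"
    by linarith
  then show ?case
  proof cases
    case 1
    then show ?thesis using gamma_nonneg_path less.prems by simp
  next
    case 2
    then show ?thesis using gamma_nonneg_star less.prems by simp
  next
    case 3
    have "gamma_nonneg (Suc ((n - 1) + (k - 1))) ([:1, 1:] * (broom_h_poly n 0 * broom_h_poly 0 k))"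
      by (intro gamma_nonneg_one_plus_mult gamma_nonneg_mult gamma_nonneg_path gamma_nonneg_star 3)
    moreover have "Suc ((n - 1) + (k - 1)) = n + k - 1"
      using 3 by simp
    ultimately have "gamma_nonneg (n + k - 1) ([:1, 1:] * (broom_h_poly n 0 * broom_h_poly 0 k))"
      by metis
    moreover have "gamma_nonneg (n + k - 1) ([:0, 1:] * (case z of (i, j) \<Rightarrow>
        of_nat (k choose j) * (broom_h_poly i 0 * broom_h_poly 0 j * broom_h_poly (n - i) (k - j))))"
      if z: "z \<in> {1..n} \<times> {1..k} - {(n, k)}" for z
    proof -
      obtain i j where ij: "z = (i, j)"
        by (rule prod.exhaust)
      then have le: "1 \<le> i" "i \<le> n" "1 \<le> j" "j \<le> k" "1 \<le> (n - i) + (k - j)"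
        using z by auto
      then have "gamma_nonneg ((n - i) + (k - j) - 1) (broom_h_poly (n - i) (k - j))"
        by (intro less.hyps) auto
      then have "gamma_nonneg ((i - 1) + (j - 1) + ((n - i) + (k - j) - 1))
          (of_nat (k choose j) * (broom_h_poly i 0 * broom_h_poly 0 j * broom_h_poly (n - i) (k - j)))"
        using le by (intro gamma_nonneg_of_nat_mult gamma_nonneg_mult gamma_nonneg_path gamma_nonneg_star)
      moreover have "Suc (Suc ((i - 1) + (j - 1) + ((n - i) + (k - j) - 1))) = n + k - 1"
        using le by linarith
      ultimately show ?thesis
        unfolding ij prod.case using gamma_nonneg_var_mult by metis
    qed
    ultimately show ?thesis
      unfolding broom_h_poly_broom[OF 3] sum_distrib_left
      by (intro gamma_nonneg_add gamma_nonneg_sum)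
  qed
qed

theorem corollary4p10:
  fixes n k :: nat
  assumes "n + k \<ge> 1"
  shows "\<exists>\<gamma>.
    is_gamma_vector (n + k - 1) (h_poly (tubing_f_poly (broom n k))) \<gamma> \<and>
    (\<forall>S :: 'v::euclidean_space set. poset_associahedron (broom n k) S \<longrightarrow>
       is_gamma_vector (nat (aff_dim S)) (h_poly (polytope_f_poly S)) \<gamma>) \<and>
    (\<forall>c \<in> set \<gamma>. 0 \<le> c)"
proof -
  obtain \<gamma> where \<gamma>: "is_gamma_vector (n + k - 1) (h_poly (tubing_f_poly (broom n k))) \<gamma>"
      "\<forall>c \<in> set \<gamma>. 0 \<le> c"
    using gamma_nonneg_imp_gamma_vector[OF gamma_nonneg_broom[OF assms]]
    unfolding broom_h_poly_def by blast
  have "is_gamma_vector (nat (aff_dim S)) (h_poly (polytope_f_poly S)) \<gamma>"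
    if S: "poset_associahedron (broom n k) S" for S :: "'v set"
  proof -
    have "aff_dim S = int (n + k - 1)"
      using S assms by (auto simp: poset_associahedron_def card_Field_broom)
    moreover have "polytope_f_poly S = tubing_f_poly (broom n k)"
      using assms by (intro polytope_f_poly_eq_tubing_f_poly[OF S]) (simp add: card_Field_broom)
    ultimately show ?thesis
      using \<gamma>(1) by simp
  qed
  with \<gamma> show ?thesis
    by blast
qed

end
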